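(* Let $E$ be a minimal operator space, $F$ a maximal operator space and $T:E\to F$ an operator of rank at most $n$. Then $$\gamma_2^*(T)\le170\,\big\|\mathrm{Id}_{M_n}\otimes T:M_n(E)\to M_n(F)\big\|.$$ Furthermore, for every $n$-dimensional Banach space $E$, $$\sqrt n\le(\pi(1+\sqrt2))^2\,\big\|\mathrm{Id}:\min(E)\to\max(E)\big\|_{cb}.$$
   Context: All spaces are complex. An operator space is a closed subspace of some $B(H)$ with the induced matrix norms on $M_n(E)$; $\|u\|_{cb}=\sup_n\|\mathrm{Id}_{M_n}\otimes u\|$. The operator space dual $E^*$ has the matrix norms $M_n(E^* )=CB(E,M_n)$. For a Banach space $E$, $\min(E)$ is $E$ with the structure induced by the isometric embedding $E\hookrightarrow C(B_{E^*})$, and $\max(E)$ is $E$ with the structure induced by $E\hookrightarrow(\min(E^* ))^*$. A minimal (maximal) operator space is one of the form $\min(X)$ ($\max(X)$). For an operator $S:X\to Y$ between Banach spaces, $\gamma_2(S)=\inf\|u\|\,\|v\|$, the infimum over all Hilbert spaces $H$ and factorizations $\iota_YS=uv$ with $v:X\to H$, $u:H\to Y^{**}$ bounded, $\iota_Y:Y\to Y^{**}$ the canonical embedding. For $T:Y\to X$, $\gamma_2^*(T)=\sup\{|\mathrm{tr}(ST)|: S:X\to Y\text{ of finite rank},\ \gamma_2(S)\le1\}$. *)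

theory Defs
  imports "HOL-Analysis.Analysis"
begin

section \<open>Complex Banach spaces and bounded complex-linear operators\<close>

class complex_vector = real_vector +
  fixes scaleC :: "complex \<Rightarrow> 'a \<Rightarrow> 'a"  (infixr \<open>*\<^sub>C\<close> 75)
  assumes scaleC_add_right: "a *\<^sub>C (x + y) = a *\<^sub>C x + a *\<^sub>C y"
    and scaleC_add_left: "(a + b) *\<^sub>C x = a *\<^sub>C x + b *\<^sub>C x"
    and scaleC_scaleC: "a *\<^sub>C (b *\<^sub>C x) = (a * b) *\<^sub>C x"
    and scaleC_one: "1 *\<^sub>C x = x"
    and scaleR_scaleC: "r *\<^sub>R x = complex_of_real r *\<^sub>C x"

class complex_normed_vector = real_normed_vector + complex_vector +
  assumes norm_scaleC: "norm (a *\<^sub>C x) = cmod a * norm x"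

class cbanach = complex_normed_vector + banach

global_interpretation complex_vector: vector_space "scaleC :: complex \<Rightarrow> 'a \<Rightarrow> 'a::complex_vector"
  defines cspan = complex_vector.span
    and cdependent = complex_vector.dependent
    and crepresentation = complex_vector.representation
  by unfold_locales (simp_all add: scaleC_add_right scaleC_add_left scaleC_scaleC scaleC_one)

instantiation complex :: cbanach
begin
definition scaleC_complex :: "complex \<Rightarrow> complex \<Rightarrow> complex" where
  "scaleC_complex a x = a * x"
instance
  by standard (simp_all add: scaleC_complex_def algebra_simps norm_mult scaleR_conv_of_real)
end

typedef (overloaded) ('a, 'b) cblinfun =
  "{f :: 'a::complex_normed_vector \<Rightarrow>\<^sub>L 'b::complex_normed_vector.
      \<forall>c x. blinfun_apply f (c *\<^sub>C x) = c *\<^sub>C blinfun_apply f x}"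
  by (rule exI[of _ 0]) (simp add: complex_vector.scale_zero_right)

type_notation cblinfun  (\<open>(_ \<Rightarrow>\<^sub>C\<^sub>L /_)\<close> [22, 21] 21)

setup_lifting type_definition_cblinfun

lift_definition cblinfun_apply ::
    "('a::complex_normed_vector \<Rightarrow>\<^sub>C\<^sub>L 'b::complex_normed_vector) \<Rightarrow> 'a \<Rightarrow> 'b"
  is blinfun_apply .

declare [[coercion cblinfun_apply]]

lemma scaleR_scaleC_commute: "r *\<^sub>R (c *\<^sub>C x) = c *\<^sub>C (r *\<^sub>R (x::'a::complex_vector))"
  by (simp add: scaleR_scaleC scaleC_scaleC mult.commute)

lemma bounded_linear_scaleC_blinfun:
  fixes f :: "'a::complex_normed_vector \<Rightarrow>\<^sub>L 'b::complex_normed_vector"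
  shows "bounded_linear (\<lambda>x. a *\<^sub>C blinfun_apply f x)"
proof (rule bounded_linear_intro[where K = "cmod a * norm f"])
  fix x
  have "cmod a * norm (f x) \<le> cmod a * (norm f * norm x)"
    by (intro mult_left_mono norm_blinfun) simp
  then show "norm (a *\<^sub>C f x) \<le> norm x * (cmod a * norm f)"
    by (simp add: norm_scaleC algebra_simps)
qed (simp_all add: blinfun.add_right scaleC_add_right blinfun.scaleR_right scaleR_scaleC_commute)

definition scaleC_blinfun :: "complex \<Rightarrow> ('a \<Rightarrow>\<^sub>L 'b) \<Rightarrow> 'a::complex_normed_vector \<Rightarrow>\<^sub>L 'b::complex_normed_vector"
  where "scaleC_blinfun a f = Blinfun (\<lambda>x. a *\<^sub>C blinfun_apply f x)"

lemma apply_scaleC_blinfun: "blinfun_apply (scaleC_blinfun a f) x = a *\<^sub>C f x"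
  by (simp add: scaleC_blinfun_def bounded_linear_Blinfun_apply bounded_linear_scaleC_blinfun)

instantiation cblinfun :: (complex_normed_vector, complex_normed_vector) complex_normed_vector
begin

lift_definition zero_cblinfun :: "'a \<Rightarrow>\<^sub>C\<^sub>L 'b" is 0
  by (simp add: complex_vector.scale_zero_right)
lift_definition plus_cblinfun :: "'a \<Rightarrow>\<^sub>C\<^sub>L 'b \<Rightarrow> 'a \<Rightarrow>\<^sub>C\<^sub>L 'b \<Rightarrow> 'a \<Rightarrow>\<^sub>C\<^sub>L 'b" is "(+)"
  by (simp add: blinfun.add_left scaleC_add_right)
lift_definition minus_cblinfun :: "'a \<Rightarrow>\<^sub>C\<^sub>L 'b \<Rightarrow> 'a \<Rightarrow>\<^sub>C\<^sub>L 'b \<Rightarrow> 'a \<Rightarrow>\<^sub>C\<^sub>L 'b" is "(-)"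
  by (simp add: blinfun.diff_left complex_vector.scale_right_diff_distrib)
lift_definition uminus_cblinfun :: "'a \<Rightarrow>\<^sub>C\<^sub>L 'b \<Rightarrow> 'a \<Rightarrow>\<^sub>C\<^sub>L 'b" is "uminus"
  by (simp add: blinfun.minus_left complex_vector.scale_minus_right)
lift_definition scaleR_cblinfun :: "real \<Rightarrow> 'a \<Rightarrow>\<^sub>C\<^sub>L 'b \<Rightarrow> 'a \<Rightarrow>\<^sub>C\<^sub>L 'b" is "scaleR"
  by (simp add: blinfun.scaleR_left scaleR_scaleC_commute)
lift_definition norm_cblinfun :: "'a \<Rightarrow>\<^sub>C\<^sub>L 'b \<Rightarrow> real" is norm .
lift_definition scaleC_cblinfun :: "complex \<Rightarrow> 'a \<Rightarrow>\<^sub>C\<^sub>L 'b \<Rightarrow> 'a \<Rightarrow>\<^sub>C\<^sub>L 'b"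
  is scaleC_blinfun
  by (simp add: apply_scaleC_blinfun scaleC_scaleC mult.commute)

definition dist_cblinfun :: "'a \<Rightarrow>\<^sub>C\<^sub>L 'b \<Rightarrow> 'a \<Rightarrow>\<^sub>C\<^sub>L 'b \<Rightarrow> real" where
  "dist_cblinfun f g = norm (f - g)"
definition sgn_cblinfun :: "'a \<Rightarrow>\<^sub>C\<^sub>L 'b \<Rightarrow> 'a \<Rightarrow>\<^sub>C\<^sub>L 'b" where
  "sgn_cblinfun f = inverse (norm f) *\<^sub>R f"
definition uniformity_cblinfun :: "(('a \<Rightarrow>\<^sub>C\<^sub>L 'b) \<times> ('a \<Rightarrow>\<^sub>C\<^sub>L 'b)) filter" where
  "uniformity_cblinfun = (INF e\<in>{0<..}. principal {(f, g). dist f g < e})"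
definition open_cblinfun :: "('a \<Rightarrow>\<^sub>C\<^sub>L 'b) set \<Rightarrow> bool" where
  "open_cblinfun U = (\<forall>f\<in>U. \<forall>\<^sub>F (f', g) in uniformity. f' = f \<longrightarrow> g \<in> U)"

instance
proof
  fix f g h :: "'a \<Rightarrow>\<^sub>C\<^sub>L 'b" and a b :: complex and r s :: real
  show "f + g + h = f + (g + h)" "f + g = g + f" "0 + f = f" "- f + f = 0" "f - g = f + - g"
    by (transfer, simp)+
  show "r *\<^sub>R (f + g) = r *\<^sub>R f + r *\<^sub>R g" "(r + s) *\<^sub>R f = r *\<^sub>R f + s *\<^sub>R f"
    "r *\<^sub>R s *\<^sub>R f = (r * s) *\<^sub>R f" "1 *\<^sub>R f = f"
    by (transfer, simp add: scaleR_add_right scaleR_add_left)+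
  show "norm f = 0 \<longleftrightarrow> f = 0" "norm (f + g) \<le> norm f + norm g" "norm (r *\<^sub>R f) = \<bar>r\<bar> * norm f"
    by (transfer, simp add: norm_triangle_ineq)+
  show "a *\<^sub>C (f + g) = a *\<^sub>C f + a *\<^sub>C g" "(a + b) *\<^sub>C f = a *\<^sub>C f + b *\<^sub>C f"
    "a *\<^sub>C (b *\<^sub>C f) = (a * b) *\<^sub>C f" "1 *\<^sub>C f = f" "r *\<^sub>R f = complex_of_real r *\<^sub>C f"
    by (transfer, rule blinfun_eqI,
        simp add: apply_scaleC_blinfun blinfun.add_left blinfun.scaleR_left
          scaleC_add_right scaleC_add_left scaleC_scaleC scaleC_one scaleR_scaleC)+
  show "norm (a *\<^sub>C f) = cmod a * norm f"
  proof (transfer, rule antisym)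
    fix f :: "'a \<Rightarrow>\<^sub>L 'b" and a :: complex
    have le: "norm (scaleC_blinfun a g) \<le> cmod a * norm g" for a and g :: "'a \<Rightarrow>\<^sub>L 'b"
    proof (rule norm_blinfun_bound)
      fix x
      have "cmod a * norm (g x) \<le> cmod a * (norm g * norm x)"
        by (intro mult_left_mono norm_blinfun) simp
      then show "norm (scaleC_blinfun a g x) \<le> cmod a * norm g * norm x"
        by (simp add: apply_scaleC_blinfun norm_scaleC
            algebra_simps)
    qed simp
    show "norm (scaleC_blinfun a f) \<le> cmod a * norm f" by (rule le)
    show "cmod a * norm f \<le> norm (scaleC_blinfun a f)"
    proof (cases "a = 0")
      case False
      let ?g = "scaleC_blinfun a f"
      have "f = scaleC_blinfun (inverse a) ?g"
        by (rule blinfun_eqI)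
          (simp add: apply_scaleC_blinfun scaleC_scaleC
            scaleC_one False)
      then have "norm f \<le> cmod (inverse a) * norm ?g"
        using le[of "inverse a" ?g] by simp
      then have "cmod a * norm f \<le> cmod a * (cmod (inverse a) * norm ?g)"
        by (intro mult_left_mono) simp_all
      then show ?thesis using False by (simp add: norm_inverse) (simp add: field_simps)
    qed simp
  qed
qed (simp_all add: dist_cblinfun_def sgn_cblinfun_def uniformity_cblinfun_def open_cblinfun_def)

end

instance cblinfun :: (complex_normed_vector, cbanach) cbanach
proof
  fix X :: "nat \<Rightarrow> 'a \<Rightarrow>\<^sub>C\<^sub>L 'b"
  assume "Cauchy X"
  then have "Cauchy (\<lambda>k. Rep_cblinfun (X k))"
    unfolding Cauchy_def dist_norm norm_cblinfun.rep_eq minus_cblinfun.rep_eq .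
  then obtain l where l: "(\<lambda>k. Rep_cblinfun (X k)) \<longlonglongrightarrow> l"
    using Cauchy_convergent convergent_def by blast
  have pt: "(\<lambda>k. Rep_cblinfun (X k) x) \<longlonglongrightarrow> l x" for x
    by (intro blinfun.tendsto l tendsto_const)
  have "l (c *\<^sub>C x) = c *\<^sub>C l x" for c x
  proof (rule LIMSEQ_unique[OF pt[of "c *\<^sub>C x"]])
    have "bounded_linear (\<lambda>y::'b. c *\<^sub>C y)"
      using bounded_linear_scaleC_blinfun[of c id_blinfun] by simp
    then have "(\<lambda>k. c *\<^sub>C Rep_cblinfun (X k) x) \<longlonglongrightarrow> c *\<^sub>C l x"
      by (rule bounded_linear.tendsto[OF _ pt])
    then show "(\<lambda>k. Rep_cblinfun (X k) (c *\<^sub>C x)) \<longlonglongrightarrow> c *\<^sub>C l x"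
      using Rep_cblinfun[of "X _"] by simp
  qed
  then have "Rep_cblinfun (Abs_cblinfun l) = l"
    by (simp add: Abs_cblinfun_inverse)
  then have "X \<longlonglongrightarrow> Abs_cblinfun l"
    using l unfolding LIMSEQ_def dist_norm norm_cblinfun.rep_eq minus_cblinfun.rep_eq by simp
  then show "convergent X"
    by (rule convergentI)
qed


lift_definition cblinfun_compose :: "('b::complex_normed_vector \<Rightarrow>\<^sub>C\<^sub>L 'c::complex_normed_vector)
    \<Rightarrow> ('a::complex_normed_vector \<Rightarrow>\<^sub>C\<^sub>L 'b) \<Rightarrow> 'a \<Rightarrow>\<^sub>C\<^sub>L 'c"  (infixl \<open>o\<^sub>C\<^sub>L\<close> 67)
  is blinfun_compose
  by simp

lemma cblinfun_compose_apply: "(f o\<^sub>C\<^sub>L g) x = f (g x)"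
  by transfer simp

lemma cblinfun_apply_scaleC: "cblinfun_apply f (c *\<^sub>C x) = c *\<^sub>C f x"
  by transfer simp

lemma cblinfun_apply_add: "cblinfun_apply f (x + y) = f x + f y"
  by transfer (simp add: blinfun.add_right)

lemma norm_cblinfun: "norm (cblinfun_apply f x) \<le> norm f * norm x"
  by transfer (rule norm_blinfun)

type_synonym 'a dual = "'a \<Rightarrow>\<^sub>C\<^sub>L complex"

lemma bounded_linear_eval_dual: "bounded_linear (\<lambda>f::'a::complex_normed_vector dual. f x)"
  by (rule bounded_linear_intro[where K = "norm x"])
    (transfer, simp add: blinfun.add_left blinfun.scaleR_left,
     transfer, simp add: blinfun.add_left blinfun.scaleR_left, rule norm_cblinfun)

lemma scaleC_cblinfun_apply: "cblinfun_apply (c *\<^sub>C f) x = c *\<^sub>C cblinfun_apply f x"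
  by transfer (simp add: apply_scaleC_blinfun)

lift_definition bidual_embed :: "'a::complex_normed_vector \<Rightarrow> 'a dual dual"
  is "\<lambda>x. Blinfun (\<lambda>f. cblinfun_apply f x)"
  by (simp add: bounded_linear_Blinfun_apply bounded_linear_eval_dual scaleC_cblinfun_apply)

lemma bidual_embed_apply: "cblinfun_apply (bidual_embed x) f = f x"
  by transfer (simp add: bounded_linear_Blinfun_apply bounded_linear_eval_dual)


section \<open>Rank, dimension and trace\<close>

definition rank_at_most :: "('a::complex_normed_vector \<Rightarrow>\<^sub>C\<^sub>L 'b::complex_normed_vector) \<Rightarrow> nat \<Rightarrow> bool"
  where "rank_at_most T n \<longleftrightarrow> (\<exists>B. finite B \<and> card B \<le> n \<and> range T \<subseteq> cspan B)"

definition finite_rank :: "('a::complex_normed_vector \<Rightarrow>\<^sub>C\<^sub>L 'b::complex_normed_vector) \<Rightarrow> bool"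
  where "finite_rank T \<longleftrightarrow> (\<exists>n. rank_at_most T n)"

definition has_cdim :: "'a::complex_vector set \<Rightarrow> nat \<Rightarrow> bool"
  where "has_cdim V n \<longleftrightarrow> (\<exists>B\<subseteq>V. finite B \<and> card B = n \<and> \<not> cdependent B \<and> cspan B = V)"

text \<open>The trace of a finite rank operator is the trace of its restriction to any
  finite-dimensional subspace containing its range. The lemmas below show that the description
  is unambiguous for finite rank operators and that the trace of \<open>\<Sum>\<^sub>i f\<^sub>i \<otimes> x\<^sub>i\<close> is \<open>\<Sum>\<^sub>i f\<^sub>i(x\<^sub>i)\<close>.\<close>

definition ctrace :: "('a::complex_normed_vector \<Rightarrow>\<^sub>C\<^sub>L 'a) \<Rightarrow> complex" where
  "ctrace A = (THE t. \<exists>B. finite B \<and> \<not> cdependent B \<and> range A \<subseteq> cspan B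
     \<and> t = (\<Sum>b\<in>B. crepresentation B (A b) b))"

lemma basis_trace_eq:
  fixes A :: "'a::complex_vector \<Rightarrow> 'a"
  assumes B: "finite B" "\<not> cdependent B" "range A \<subseteq> cspan B"
    and I: "finite I" and f_add: "\<And>i u v. f i (u + v) = f i u + f i v"
    and f_scale: "\<And>i c u. f i (c *\<^sub>C u) = c * f i u"
    and A: "\<And>z. A z = (\<Sum>i\<in>I. f i z *\<^sub>C x i)"
  shows "(\<Sum>b\<in>B. crepresentation B (A b) b) = (\<Sum>i\<in>I. f i (x i))"
proof -
  define H where "H = complex_vector.extend_basis B"
  have H: "\<not> cdependent H" "B \<subseteq> H" "cspan H = UNIV"
    unfolding H_def using B(2) complex_vector.independent_extend_basis
      complex_vector.extend_basis_superset complex_vector.span_extend_basis by auto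
  let ?R = "crepresentation H"
  have RB: "?R (A z) = crepresentation B (A z)" for z
    by (rule complex_vector.representation_extend[OF H(1) _ H(2)]) (use B(3) in auto)
  define C where "C = B \<union> (\<Union>i\<in>I. {b. ?R (x i) b \<noteq> 0})"
  have C: "finite C" "B \<subseteq> C"
    unfolding C_def using B(1) I complex_vector.finite_representation by auto
  have f_0: "f i 0 = 0" for i
    using f_scale[of i 0 0] by (simp add: complex_vector.scale_zero_left)
  have f_sum: "f i (\<Sum>c\<in>C. r c *\<^sub>C c) = (\<Sum>c\<in>C. r c * f i c)" for i r
    using C(1) by induction (simp_all add: f_0 f_add f_scale)
  have x: "x i = (\<Sum>c\<in>C. ?R (x i) c *\<^sub>C c)" if "i \<in> I" for i
  proof -
    have "x i = (\<Sum>b | ?R (x i) b \<noteq> 0. ?R (x i) b *\<^sub>C b)"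
      using complex_vector.sum_nonzero_representation_eq[OF H(1), of "x i"] H(3) by simp
    also have "\<dots> = (\<Sum>c\<in>C. ?R (x i) c *\<^sub>C c)"
      by (rule sum.mono_neutral_left) (use C that in \<open>auto simp: C_def complex_vector.scale_zero_left\<close>)
    finally show ?thesis .
  qed
  have "(\<Sum>i\<in>I. f i (x i)) = (\<Sum>i\<in>I. \<Sum>c\<in>C. ?R (x i) c * f i c)"
    by (rule sum.cong) (use x f_sum in metis)+
  also have "\<dots> = (\<Sum>c\<in>C. \<Sum>i\<in>I. f i c * ?R (x i) c)"
    by (subst sum.swap) (simp add: mult.commute)
  also have "\<dots> = (\<Sum>c\<in>C. ?R (A c) c)"
    unfolding A using H
    by (simp add: complex_vector.representation_sum complex_vector.representation_scale)
  also have "\<dots> = (\<Sum>c\<in>B. ?R (A c) c)"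
    unfolding RB
    by (rule sum.mono_neutral_right)
      (use C complex_vector.representation_ne_zero in blast)+
  finally show ?thesis by (simp add: RB)
qed

lemma ctrace_eq_basis:
  assumes B: "finite B" "\<not> cdependent B" "range (cblinfun_apply A) \<subseteq> cspan B"
  shows "ctrace A = (\<Sum>b\<in>B. crepresentation B (A b) b)"
  unfolding ctrace_def
proof (rule the_equality)
  fix t
  assume "\<exists>B. finite B \<and> \<not> cdependent B \<and> range A \<subseteq> cspan B
    \<and> t = (\<Sum>b\<in>B. crepresentation B (A b) b)"
  then obtain B' where B': "finite B'" "\<not> cdependent B'" "range A \<subseteq> cspan B'"
    "t = (\<Sum>b\<in>B'. crepresentation B' (A b) b)" by blast
  have in': "A z \<in> cspan B'" for z using B'(3) by blast
  have "(\<Sum>b\<in>B. crepresentation B (A b) b) = (\<Sum>b\<in>B'. crepresentation B' (A b) b)"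
    by (rule basis_trace_eq[OF B B'(1)])
      (simp_all add: cblinfun_apply_add cblinfun_apply_scaleC B' in'
        complex_vector.representation_add complex_vector.representation_scale
        complex_vector.sum_representation_eq)
  then show "t = (\<Sum>b\<in>B. crepresentation B (A b) b)" using B'(4) by simp
qed (use B in blast)

lemma finite_rank_basis:
  assumes "finite_rank A"
  obtains B where "finite B" "\<not> cdependent B" "range (cblinfun_apply A) \<subseteq> cspan B"
proof -
  obtain B where B: "finite B" "range A \<subseteq> cspan B"
    using assms unfolding finite_rank_def rank_at_most_def by blast
  obtain B' where B': "B' \<subseteq> B" "\<not> cdependent B'" "B \<subseteq> cspan B'"
    using complex_vector.maximal_independent_subset[of B] by blast
  have "cspan B \<subseteq> cspan B'"
    by (rule complex_vector.span_minimal[OF B'(3) complex_vector.subspace_span])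
  with B(2) have "range A \<subseteq> cspan B'" by (rule order_trans)
  then show ?thesis
    by (rule that[OF finite_subset[OF B'(1) B(1)] B'(2)])
qed

lemma ctrace_eq_sum:
  fixes f :: "'i \<Rightarrow> 'a::complex_normed_vector dual"
  assumes "finite I" and A: "\<And>z. cblinfun_apply A z = (\<Sum>i\<in>I. f i z *\<^sub>C x i)"
  shows "ctrace A = (\<Sum>i\<in>I. f i (x i))"
proof -
  have "range A \<subseteq> cspan (x ` I)"
    unfolding A image_subset_iff
    by (intro ballI complex_vector.span_sum complex_vector.span_scale complex_vector.span_base) blast
  then have "finite_rank A"
    using \<open>finite I\<close> unfolding finite_rank_def rank_at_most_def by blast
  then obtain B where B: "finite B" "\<not> cdependent B" "range A \<subseteq> cspan B"
    by (rule finite_rank_basis)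
  show ?thesis
    unfolding ctrace_eq_basis[OF B]
    by (rule basis_trace_eq[OF B \<open>finite I\<close> _ _ A])
      (simp_all add: cblinfun_apply_add cblinfun_apply_scaleC scaleC_complex_def)
qed


section \<open>Matrix norms and operator space structures\<close>

text \<open>Norm of a complex matrix with rows and columns indexed by the finite set \<open>I\<close>, as an operator
  on \<open>\<ell>\<^sub>2(I)\<close>.\<close>

definition mat_norm :: "'i set \<Rightarrow> ('i \<Rightarrow> 'i \<Rightarrow> complex) \<Rightarrow> ennreal" where
  "mat_norm I A = (SUP \<xi>\<in>{\<xi>. L2_set (\<lambda>j. cmod (\<xi> j)) I \<le> 1}.
     ennreal (L2_set (\<lambda>i. cmod (\<Sum>j\<in>I. A i j * \<xi> j)) I))"

text \<open>A sequence of matrix norms on \<open>'a\<close>: the value at \<open>n\<close> and \<open>x\<close> is the norm in \<open>M\<^sub>n('a)\<close> of the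
  matrix \<open>(x i j)\<close>, \<open>i, j < n\<close>; entries outside this range are ignored.\<close>

type_synonym 'a mnorms = "nat \<Rightarrow> (nat \<Rightarrow> nat \<Rightarrow> 'a) \<Rightarrow> ennreal"

definition amp_norm :: "nat \<Rightarrow> 'a mnorms \<Rightarrow> 'b mnorms \<Rightarrow> ('a \<Rightarrow> 'b) \<Rightarrow> ennreal" where
  "amp_norm n N M T = (SUP x\<in>{x. N n x \<le> 1}. M n (\<lambda>i j. T (x i j)))"

definition cb_norm :: "'a mnorms \<Rightarrow> 'b mnorms \<Rightarrow> ('a \<Rightarrow> 'b) \<Rightarrow> ennreal" where
  "cb_norm N M T = (SUP n. amp_norm n N M T)"

text \<open>\<open>M\<^sub>n\<close> with its matrix norms \<open>M\<^sub>m(M\<^sub>n) = M\<^bsub>mn\<^esub> = B(\<ell>\<^sub>2({..<m} \<times> {..<n}))\<close>.\<close>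

definition mat_mnorms :: "nat \<Rightarrow> (nat \<Rightarrow> nat \<Rightarrow> complex) mnorms" where
  "mat_mnorms n m a = mat_norm ({..<m} \<times> {..<n}) (\<lambda>(k, i) (l, j). a k l i j)"

text \<open>\<open>M\<^sub>n(E\<^sup>*) = CB(E, M\<^sub>n)\<close>.\<close>

definition dual_mnorms :: "'a::complex_normed_vector mnorms \<Rightarrow> 'a dual mnorms" where
  "dual_mnorms N n f = cb_norm N (mat_mnorms n) (\<lambda>x i j. f i j x)"

text \<open>Spaces of bounded functions on \<open>K\<close> with the supremum norm, with their structure as
  subspaces of a commutative C*-algebra: \<open>M\<^sub>n(C(K)) = C(K, M\<^sub>n)\<close>.\<close>

definition fun_mnorms :: "'k set \<Rightarrow> ('k \<Rightarrow> complex) mnorms" where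
  "fun_mnorms K n f = (SUP t\<in>K. mat_norm {..<n} (\<lambda>i j. f i j t))"

definition min_mnorms :: "'a::complex_normed_vector mnorms" where
  "min_mnorms n x = fun_mnorms {\<phi> :: 'a dual. norm \<phi> \<le> 1} n (\<lambda>i j \<phi>. \<phi> (x i j))"

definition max_mnorms :: "'a::complex_normed_vector mnorms" where
  "max_mnorms n x = dual_mnorms (min_mnorms :: 'a dual mnorms) n (\<lambda>i j. bidual_embed (x i j))"


section \<open>Factorization through Hilbert spaces\<close>

record 'h hspace =
  hcarrier :: "'h set"
  hadd :: "'h \<Rightarrow> 'h \<Rightarrow> 'h"
  hzero :: 'h
  hscale :: "complex \<Rightarrow> 'h \<Rightarrow> 'h"
  hinner :: "'h \<Rightarrow> 'h \<Rightarrow> complex"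

definition hnorm :: "'h hspace \<Rightarrow> 'h \<Rightarrow> real" where
  "hnorm H x = sqrt (Re (hinner H x x))"

definition hdist :: "'h hspace \<Rightarrow> 'h \<Rightarrow> 'h \<Rightarrow> real" where
  "hdist H x y = hnorm H (hadd H x (hscale H (-1) y))"

locale hilbert_space =
  fixes H :: "'h hspace"
  assumes zero_closed: "hzero H \<in> hcarrier H"
    and add_closed: "x \<in> hcarrier H \<Longrightarrow> y \<in> hcarrier H \<Longrightarrow> hadd H x y \<in> hcarrier H"
    and scale_closed: "x \<in> hcarrier H \<Longrightarrow> hscale H a x \<in> hcarrier H"
    and add_assoc: "x \<in> hcarrier H \<Longrightarrow> y \<in> hcarrier H \<Longrightarrow> z \<in> hcarrier H \<Longrightarrow>
      hadd H (hadd H x y) z = hadd H x (hadd H y z)"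
    and add_commute: "x \<in> hcarrier H \<Longrightarrow> y \<in> hcarrier H \<Longrightarrow> hadd H x y = hadd H y x"
    and add_zero: "x \<in> hcarrier H \<Longrightarrow> hadd H (hzero H) x = x"
    and add_inverse: "x \<in> hcarrier H \<Longrightarrow> hadd H x (hscale H (-1) x) = hzero H"
    and scale_add_right: "x \<in> hcarrier H \<Longrightarrow> y \<in> hcarrier H \<Longrightarrow>
      hscale H a (hadd H x y) = hadd H (hscale H a x) (hscale H a y)"
    and scale_add_left: "x \<in> hcarrier H \<Longrightarrow>
      hscale H (a + b) x = hadd H (hscale H a x) (hscale H b x)"
    and scale_scale: "x \<in> hcarrier H \<Longrightarrow> hscale H a (hscale H b x) = hscale H (a * b) x"
    and scale_one: "x \<in> hcarrier H \<Longrightarrow> hscale H 1 x = x"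
    and inner_add_left: "x \<in> hcarrier H \<Longrightarrow> y \<in> hcarrier H \<Longrightarrow> z \<in> hcarrier H \<Longrightarrow>
      hinner H (hadd H x y) z = hinner H x z + hinner H y z"
    and inner_scale_left: "x \<in> hcarrier H \<Longrightarrow> y \<in> hcarrier H \<Longrightarrow>
      hinner H (hscale H a x) y = a * hinner H x y"
    and inner_commute: "x \<in> hcarrier H \<Longrightarrow> y \<in> hcarrier H \<Longrightarrow> hinner H x y = cnj (hinner H y x)"
    and inner_pos: "x \<in> hcarrier H \<Longrightarrow> x \<noteq> hzero H \<Longrightarrow> Re (hinner H x x) > 0"
    and complete: "(\<And>k. s k \<in> hcarrier H) \<Longrightarrow>
      (\<And>e. e > 0 \<Longrightarrow> \<exists>N. \<forall>m\<ge>N. \<forall>n\<ge>N. hdist H (s m) (s n) < e) \<Longrightarrow>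
      \<exists>l\<in>hcarrier H. (\<lambda>k. hdist H (s k) l) \<longlonglongrightarrow> 0"

definition bounded_into :: "'h hspace \<Rightarrow> ('a::complex_normed_vector \<Rightarrow> 'h) \<Rightarrow> bool" where
  "bounded_into H v \<longleftrightarrow> range v \<subseteq> hcarrier H
     \<and> (\<forall>x y. v (x + y) = hadd H (v x) (v y)) \<and> (\<forall>c x. v (c *\<^sub>C x) = hscale H c (v x))
     \<and> (\<exists>K. \<forall>x. hnorm H (v x) \<le> K * norm x)"

definition norm_into :: "'h hspace \<Rightarrow> ('a::complex_normed_vector \<Rightarrow> 'h) \<Rightarrow> ennreal" where
  "norm_into H v = (SUP x\<in>{x. norm x \<le> 1}. ennreal (hnorm H (v x)))"

definition bounded_from :: "'h hspace \<Rightarrow> ('h \<Rightarrow> 'b::complex_normed_vector) \<Rightarrow> bool" where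
  "bounded_from H u \<longleftrightarrow>
     (\<forall>g\<in>hcarrier H. \<forall>h\<in>hcarrier H. u (hadd H g h) = u g + u h)
     \<and> (\<forall>c. \<forall>h\<in>hcarrier H. u (hscale H c h) = c *\<^sub>C u h)
     \<and> (\<exists>K. \<forall>h\<in>hcarrier H. norm (u h) \<le> K * hnorm H h)"

definition norm_from :: "'h hspace \<Rightarrow> ('h \<Rightarrow> 'b::complex_normed_vector) \<Rightarrow> ennreal" where
  "norm_from H u = (SUP h\<in>{h \<in> hcarrier H. hnorm H h \<le> 1}. ennreal (norm (u h)))"

definition hilbert_factorization ::
    "('a::complex_normed_vector \<Rightarrow>\<^sub>C\<^sub>L 'b::complex_normed_vector) \<Rightarrow> 'h hspace
      \<Rightarrow> ('h \<Rightarrow> 'b dual dual) \<Rightarrow> ('a \<Rightarrow> 'h) \<Rightarrow> bool" where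
  "hilbert_factorization S H u v \<longleftrightarrow> hilbert_space H \<and> bounded_into H v \<and> bounded_from H u
     \<and> (\<forall>x. bidual_embed (S x) = u (v x))"

text \<open>HOL cannot quantify over all types inside a definition, so the Hilbert spaces range over those
  whose elements are taken from the type \<open>'a \<Rightarrow> complex\<close>. By lemma \<open>gamma2_le\<close> below, this gives the
  infimum over all Hilbert spaces.\<close>

definition gamma2 :: "('a::complex_normed_vector \<Rightarrow>\<^sub>C\<^sub>L 'b::complex_normed_vector) \<Rightarrow> ennreal" where
  "gamma2 S = Inf {norm_from H u * norm_into H v | (H :: ('a \<Rightarrow> complex) hspace) u v.
     hilbert_factorization S H u v}"

context hilbert_space
begin

lemma inner_add_right: "x \<in> hcarrier H \<Longrightarrow> y \<in> hcarrier H \<Longrightarrow> z \<in> hcarrier H \<Longrightarrow>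
    hinner H z (hadd H x y) = hinner H z x + hinner H z y"
  using inner_commute[of z "hadd H x y"] inner_commute[of z x] inner_commute[of z y]
  by (simp add: add_closed inner_add_left)

lemma inner_scale_right: "x \<in> hcarrier H \<Longrightarrow> y \<in> hcarrier H \<Longrightarrow>
    hinner H y (hscale H a x) = cnj a * hinner H y x"
  using inner_commute[of y "hscale H a x"] inner_commute[of y x]
  by (simp add: scale_closed inner_scale_left)

lemma inner_zero_left: "y \<in> hcarrier H \<Longrightarrow> hinner H (hzero H) y = 0"
  using inner_add_left[of "hzero H" "hzero H" y] add_zero[OF zero_closed] zero_closed by simp

lemma inner_self_nonneg: "x \<in> hcarrier H \<Longrightarrow> Re (hinner H x x) \<ge> 0"
  using inner_pos[of x] inner_zero_left[OF zero_closed] by (cases "x = hzero H") force+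

lemma inner_self_real: "x \<in> hcarrier H \<Longrightarrow> hinner H x x = complex_of_real (Re (hinner H x x))"
  using inner_commute[of x x] by (simp add: complex_eq_iff)

lemma cauchy_schwarz:
  assumes "x \<in> hcarrier H" "y \<in> hcarrier H"
  shows "cmod (hinner H x y) \<le> hnorm H x * hnorm H y"
proof (cases "y = hzero H")
  case True
  have "hinner H x y = 0"
    using inner_zero_left[of x] inner_commute[of x y] assms True by simp
  then show ?thesis
    unfolding hnorm_def using assms by (simp add: inner_self_nonneg)
next
  case False
  define p where "p = Re (hinner H y y)"
  define c where "c = hinner H x y"
  have p: "p > 0" "hinner H y y = complex_of_real p"
    unfolding p_def using inner_pos[OF assms(2) False] inner_self_real[OF assms(2)] by auto
  define z where "z = hadd H x (hscale H (- c / p) y)"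
  have z: "z \<in> hcarrier H" unfolding z_def using assms by (simp add: add_closed scale_closed)
  have yx: "hinner H y x = cnj c"
    unfolding c_def using inner_commute[of y x] assms by simp
  have "hinner H z z = hinner H x x - c * cnj c / p"
    unfolding z_def using assms p(1)
    by (simp add: add_closed scale_closed inner_add_left inner_add_right inner_scale_left
        inner_scale_right yx p(2) flip: c_def)
  then have "Re (hinner H z z) = Re (hinner H x x) - (cmod c)\<^sup>2 / p"
    by (simp flip: complex_norm_square of_real_power of_real_divide)
  with inner_self_nonneg[OF z] have "(cmod c)\<^sup>2 \<le> Re (hinner H x x) * p"
    using p(1) by (simp add: field_simps)
  then have "sqrt ((cmod c)\<^sup>2) \<le> sqrt (Re (hinner H x x) * p)"
    by (rule real_sqrt_le_mono)
  then show ?thesis unfolding hnorm_def c_def p_def by (simp add: real_sqrt_mult)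
qed

lemma biorthogonal_subspace:
  assumes "V \<subseteq> hcarrier H"
  defines "W \<equiv> {w \<in> hcarrier H. \<forall>x\<in>V. hinner H x w = 0}"
  defines "K \<equiv> {h \<in> hcarrier H. \<forall>w\<in>W. hinner H h w = 0}"
  shows "hilbert_space (H\<lparr>hcarrier := K\<rparr>)" (is "hilbert_space ?K")
proof -
  have sub: "h \<in> hcarrier H" if "h \<in> K" for h using that by (simp add: K_def)
  have WH: "w \<in> hcarrier H" if "w \<in> W" for w using that by (simp add: W_def)
  show ?thesis
  proof (unfold_locales, simp_all add: sub add_assoc add_zero add_inverse scale_add_right
        scale_add_left scale_scale scale_one inner_add_left inner_scale_left inner_pos hdist_def
        hnorm_def)
    show "hzero H \<in> K" by (auto simp: K_def zero_closed inner_zero_left WH)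
    show "hadd H x y \<in> K" if "x \<in> K" "y \<in> K" for x y
      using that by (auto simp: K_def add_closed inner_add_left WH)
    show "hscale H a x \<in> K" if "x \<in> K" for a x
      using that by (auto simp: K_def scale_closed inner_scale_left WH)
    show "hadd H x y = hadd H y x" if "x \<in> K" "y \<in> K" for x y
      using that sub add_commute by blast
    show "hinner H x y = cnj (hinner H y x)" if "x \<in> K" "y \<in> K" for x y
      using that sub inner_commute by blast
    fix s :: "nat \<Rightarrow> 'h"
    assume s: "\<And>k. s k \<in> K"
      and C: "\<And>e. e > 0 \<Longrightarrow> \<exists>N. \<forall>m\<ge>N. \<forall>n\<ge>N. sqrt (Re (hinner H
        (hadd H (s m) (hscale H (-1) (s n))) (hadd H (s m) (hscale H (-1) (s n))))) < e"
    obtain l where l: "l \<in> hcarrier H" "(\<lambda>k. hdist H (s k) l) \<longlonglongrightarrow> 0"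
      using complete[of s] s sub C unfolding hdist_def hnorm_def by blast
    have "l \<in> K"
    proof -
      have "hinner H l w = 0" if w: "w \<in> W" for w
      proof -
        have "cmod (hinner H l w) \<le> hdist H (s k) l * hnorm H w" for k
        proof -
          have "hinner H (hadd H (s k) (hscale H (-1) l)) w = - hinner H l w"
            using s[of k] w by (simp add: inner_add_left inner_scale_left sub scale_closed l WH)
              (simp add: K_def)
          then show ?thesis
            using cauchy_schwarz[of "hadd H (s k) (hscale H (-1) l)" w]
            by (simp add: hdist_def add_closed scale_closed sub s l WH w)
        qed
        moreover have "(\<lambda>k. hdist H (s k) l * hnorm H w) \<longlonglongrightarrow> 0 * hnorm H w"
          by (intro tendsto_intros l)
        ultimately have "cmod (hinner H l w) \<le> 0"
          by (intro LIMSEQ_le_const[of _ 0]) auto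
        then show ?thesis by simp
      qed
      with l show ?thesis by (simp add: K_def)
    qed
    then show "\<exists>l\<in>K. (\<lambda>k. sqrt (Re (hinner H (hadd H (s k) (hscale H (-1) l))
        (hadd H (s k) (hscale H (-1) l))))) \<longlonglongrightarrow> 0"
      using l unfolding hdist_def hnorm_def by blast
  qed
qed

lemma eq_if_diff_self_orthogonal:
  assumes "g \<in> hcarrier H" "h \<in> hcarrier H"
    and "hinner H (hadd H g (hscale H (-1) h)) (hadd H g (hscale H (-1) h)) = 0"
  shows "g = h"
proof -
  let ?mh = "hscale H (-1) h"
  have mh: "?mh \<in> hcarrier H" using assms by (simp add: scale_closed)
  have 0: "hadd H g ?mh = hzero H"
    using inner_pos[of "hadd H g ?mh"] assms mh by (auto simp: add_closed)
  have "hadd H (hadd H g ?mh) h = hadd H g (hadd H h ?mh)"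
    using assms mh by (simp add: add_assoc add_commute)
  then show ?thesis
    using 0 assms add_zero[of g] add_zero[of h] add_commute[of g "hzero H"]
    by (simp add: add_inverse zero_closed)
qed

end

definition transport_hspace :: "('h \<Rightarrow> 'k) \<Rightarrow> 'h hspace \<Rightarrow> 'k hspace" where
  "transport_hspace j H = (let i = inv_into (hcarrier H) j in
     \<lparr>hcarrier = j ` hcarrier H, hadd = (\<lambda>x y. j (hadd H (i x) (i y))), hzero = j (hzero H),
      hscale = (\<lambda>c x. j (hscale H c (i x))), hinner = (\<lambda>x y. hinner H (i x) (i y))\<rparr>)"

lemma hilbert_space_transport:
  fixes H :: "'h hspace" and j :: "'h \<Rightarrow> 'k"
  assumes H: "hilbert_space H" and j: "inj_on j (hcarrier H)"
  shows "hilbert_space (transport_hspace j H)"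
proof -
  interpret hilbert_space H by (rule H)
  let ?i = "inv_into (hcarrier H) j"
  have i: "?i (j h) = h" if "h \<in> hcarrier H" for h using that j by simp
  have d: "hdist (transport_hspace j H) (j g) (j h) = hdist H g h"
    if "g \<in> hcarrier H" "h \<in> hcarrier H" for g h
    using that by (simp add: hdist_def hnorm_def transport_hspace_def Let_def i add_closed scale_closed)
  show ?thesis
  proof
    fix s :: "nat \<Rightarrow> 'k"
    assume s: "\<And>k. s k \<in> hcarrier (transport_hspace j H)"
      and C: "\<And>e. e > 0 \<Longrightarrow> \<exists>N. \<forall>m\<ge>N. \<forall>n\<ge>N. hdist (transport_hspace j H) (s m) (s n) < e"
    have "\<forall>k. \<exists>h. h \<in> hcarrier H \<and> s k = j h"
      using s by (auto simp: transport_hspace_def Let_def)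
    then obtain r where r: "\<And>k. r k \<in> hcarrier H" "s = (\<lambda>k. j (r k))" by metis
    obtain l where "l \<in> hcarrier H" "(\<lambda>k. hdist H (r k) l) \<longlonglongrightarrow> 0"
      using complete[of r] r(1) C unfolding r(2) d[OF r(1) r(1)] by blast
    then show "\<exists>l\<in>hcarrier (transport_hspace j H). (\<lambda>k. hdist (transport_hspace j H) (s k) l) \<longlonglongrightarrow> 0"
      by (intro bexI[of _ "j l"]) (simp_all add: r d, simp add: transport_hspace_def Let_def)
  next
    fix x y assume "x \<in> hcarrier (transport_hspace j H)" "y \<in> hcarrier (transport_hspace j H)"
    then show "hadd (transport_hspace j H) x y = hadd (transport_hspace j H) y x"
      by (auto simp: transport_hspace_def Let_def i intro!: arg_cong[of _ _ j] add_commute)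
  next
    fix x y assume "x \<in> hcarrier (transport_hspace j H)" "y \<in> hcarrier (transport_hspace j H)"
    then show "hinner (transport_hspace j H) x y = cnj (hinner (transport_hspace j H) y x)"
      by (auto simp: transport_hspace_def Let_def i intro!: inner_commute)
  qed (auto simp: transport_hspace_def Let_def i zero_closed add_closed scale_closed add_assoc
      add_zero add_inverse scale_add_right scale_add_left scale_scale scale_one inner_add_left
      inner_scale_left intro!: inner_pos)
qed

lemma gamma2_le:
  fixes H :: "'h hspace"
  assumes "hilbert_factorization S H u v"
  shows "gamma2 S \<le> norm_from H u * norm_into H v"
proof -
  have "hilbert_space H" and v: "bounded_into H v" and u: "bounded_from H u"
    and S: "\<And>x. bidual_embed (S x) = u (v x)"
    using assms by (auto simp: hilbert_factorization_def)
  interpret hilbert_space H by fact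
  have vH: "range v \<subseteq> hcarrier H" using v by (simp add: bounded_into_def)
  define W where "W = {w \<in> hcarrier H. \<forall>x\<in>range v. hinner H x w = 0}"
  define K where "K = {h \<in> hcarrier H. \<forall>w\<in>W. hinner H h w = 0}"
  define HK where "HK = H\<lparr>hcarrier := K\<rparr>"
  have HK: "hilbert_space HK"
    unfolding HK_def K_def W_def by (rule biorthogonal_subspace[OF vH])
  interpret HK: hilbert_space HK by (rule HK)
  define j where "j h = (\<lambda>x. hinner H (v x) h)" for h
  have KH: "K \<subseteq> hcarrier H" by (auto simp: K_def)
  have vK: "v x \<in> K" for x using vH by (auto simp: K_def W_def)
  have inj: "inj_on j (hcarrier HK)"
  proof (rule inj_onI)
    fix g h assume gh: "g \<in> hcarrier HK" "h \<in> hcarrier HK" "j g = j h"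
    then have K: "g \<in> K" "h \<in> K" by (simp_all add: HK_def)
    let ?d = "hadd H g (hscale H (-1) h)"
    have d: "?d \<in> K"
      using HK.add_closed[of g "hscale H (-1) h"] HK.scale_closed[of h "-1"] K
      by (simp add: HK_def)
    have "hinner H (v x) ?d = 0" for x
      using fun_cong[OF gh(3), of x] K KH vH
      by (subst inner_add_right) (auto simp: j_def inner_scale_right scale_closed subset_iff)
    then have "?d \<in> W" using d KH by (auto simp: W_def)
    with d have "hinner H ?d ?d = 0" by (simp add: K_def)
    then show "g = h" using eq_if_diff_self_orthogonal K KH by blast
  qed
  define L where "L = transport_hspace j HK"
  define i where "i = inv_into K j"
  have i: "i (j h) = h" if "h \<in> K" for h using that inj by (simp add: i_def HK_def)
  have L: "hcarrier L = j ` K" "hadd L x y = j (hadd H (i x) (i y))"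
    "hscale L c x = j (hscale H c (i x))" "hinner L x y = hinner H (i x) (i y)" for c x y
    by (simp_all add: L_def transport_hspace_def Let_def HK_def i_def)
  have nL: "hnorm L (j h) = hnorm H h" if "h \<in> K" for h
    using that by (simp add: hnorm_def L i)
  have Kcl: "hadd H g h \<in> K" "hscale H c h \<in> K" if "g \<in> K" "h \<in> K" for g h c
    using that HK.add_closed[of g h] HK.scale_closed[of h c] by (simp_all add: HK_def)
  have "hilbert_space L" unfolding L_def by (rule hilbert_space_transport[OF HK inj])
  moreover have "bounded_into L (\<lambda>x. j (v x))"
    using v unfolding bounded_into_def by (auto simp: L vK i nL)
  moreover have "bounded_from L (\<lambda>f. u (i f))"
    using u KH unfolding bounded_from_def by (simp add: L i Kcl nL subset_iff) blast
  ultimately have "hilbert_factorization S L (\<lambda>f. u (i f)) (\<lambda>x. j (v x))"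
    by (simp add: hilbert_factorization_def S i vK)
  then have "gamma2 S \<le> norm_from L (\<lambda>f. u (i f)) * norm_into L (\<lambda>x. j (v x))"
    unfolding gamma2_def by (intro Inf_lower) blast
  also have "\<dots> \<le> norm_from H u * norm_into H v"
  proof (rule mult_mono)
    show "norm_from L (\<lambda>f. u (i f)) \<le> norm_from H u"
      unfolding norm_from_def
    proof (rule SUP_least)
      fix f assume "f \<in> {h \<in> hcarrier L. hnorm L h \<le> 1}"
      then obtain h where "f = j h" "h \<in> K" "hnorm H h \<le> 1" by (auto simp: L nL)
      then show "ennreal (norm (u (i f))) \<le> (SUP h\<in>{h \<in> hcarrier H. hnorm H h \<le> 1}. ennreal (norm (u h)))"
        using KH by (intro SUP_upper2[of h]) (auto simp: i)
    qed
    show "norm_into L (\<lambda>x. j (v x)) \<le> norm_into H v"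
      unfolding norm_into_def by (simp add: nL vK)
  qed simp_all
  finally show ?thesis .
qed

definition gamma2_star :: "('b::complex_normed_vector \<Rightarrow>\<^sub>C\<^sub>L 'a::complex_normed_vector) \<Rightarrow> ennreal" where
  "gamma2_star T = (SUP S \<in> {S :: 'a \<Rightarrow>\<^sub>C\<^sub>L 'b. finite_rank S \<and> gamma2 S \<le> 1}.
     ennreal (cmod (ctrace (S o\<^sub>C\<^sub>L T))))"

end

theory Submission
  imports Defs "Jordan_Normal_Form.Determinant"
begin

text \<open>
  Both inequalities come from one lower bound for the norm of \<open>Id \<otimes> T : M\<^sub>n(min E) \<rightarrow> M\<^sub>n(max F)\<close>.
  Suppose that \<open>x\<^sub>k \<in> E\<close> and \<open>y\<^sub>k \<in> F\<^sup>*\<close>, \<open>k < d \<le> n\<close>, are weakly \<open>\<ell>\<^sub>2\<close>-summable with constants \<open>p\<close> and \<open>q\<close>,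
  that is \<open>\<Sum> |\<phi>(x\<^sub>k)|\<^sup>2 \<le> p\<^sup>2\<close> and \<open>\<Sum> |\<Phi>(y\<^sub>k)|\<^sup>2 \<le> q\<^sup>2\<close> for all functionals \<open>\<phi>\<close>, \<open>\<Phi>\<close> of norm at most \<open>1\<close>.
  Take \<open>n \<times> n\<close> matrices \<open>U\<^sub>k\<close> with unimodular entries divided by \<open>\<surd>n\<close> such that
  \<open>\<parallel>\<Sum> a\<^sub>k U\<^sub>k\<parallel> \<le> C |a|\<close> for every \<open>a \<in> \<ell>\<^sub>2\<^sup>n\<close>, with \<open>C\<close> independent of \<open>n\<close>. Then \<open>\<Sum> x\<^sub>k \<otimes> U\<^sub>k\<close> has norm
  at most \<open>C p\<close> in \<open>M\<^sub>n(min E)\<close>, the matrix \<open>\<Sum> y\<^sub>k \<otimes> cnj U\<^sub>k\<close> has norm at most \<open>C q\<close> in \<open>M\<^sub>n(min F\<^sup>*)\<close>, and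
  pairing the image of the first with the second (this is what the maximal structure measures) and
  evaluating at the maximally entangled unit vector of \<open>\<ell>\<^sub>2\<^sup>n \<otimes> \<ell>\<^sub>2\<^sup>n\<close> gives
  \<open>\<Sum>\<^sub>k\<^sub>,\<^sub>l y\<^sub>k(T x\<^sub>l) tr(U\<^sub>k\<^sup>* U\<^sub>l) / n\<close>. The diagonal terms of this sum are \<open>y\<^sub>k(T x\<^sub>k)\<close>; a choice of signs in
  front of the \<open>x\<^sub>k\<close> and \<open>y\<^sub>k\<close> removes the effect of the others. Hence (\<open>pairing_le_amp_norm\<close>)
  \<open>|\<Sum> y\<^sub>k(T x\<^sub>k)| \<le> C\<^sup>2 p q \<parallel>Id \<otimes> T\<parallel>\<close>.

  The matrices are the slices of a random tensor with independent entries in \<open>{1, i, -1, -i}\<close>: its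
  injective norm is at most \<open>50/7 \<surd>n\<close> with positive probability, by a sub-Gaussian estimate on a net
  (\<open>exists_phase_tensor\<close>). So \<open>C\<^sup>2 = (50/7)\<^sup>2 < 51.03\<close>.

  For the first inequality let \<open>S : F \<rightarrow> E\<close> factor through a Hilbert space as \<open>S = u v\<close>. Orthonormalise
  the images under \<open>v\<close> of a basis of the range of \<open>T\<close>: there are \<open>z\<^sub>k \<in> F\<close>, at most \<open>n\<close> many, with
  \<open>v z\<^sub>k\<close> orthonormal, and \<open>tr(S T) = \<Sum> \<langle>v T S z\<^sub>k, v z\<^sub>k\<rangle>\<close>. This has the form above with
  \<open>x\<^sub>k = S z\<^sub>k = u v z\<^sub>k\<close> and \<open>y\<^sub>k = \<langle>v \<cdot>, v z\<^sub>k\<rangle>\<close>, where \<open>p = \<parallel>u\<parallel>\<close> and \<open>q = \<parallel>v\<parallel>\<close>. As the \<open>z\<^sub>k\<close> lie in \<open>F\<close>,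
  the vectors \<open>u v z\<^sub>k\<close> belong to \<open>E\<close> although \<open>u\<close> takes values in the bidual of \<open>E\<close>. A factorization with
  \<open>\<parallel>u\<parallel> \<parallel>v\<parallel> < 2\<close> already gives the constant \<open>3 C\<^sup>2 \<le> 170\<close>.

  For the second inequality, John's theorem on the ellipsoid of extremal volume gives a basis \<open>x\<^sub>k\<close> of
  \<open>E\<close> with dual basis \<open>\<psi>\<^sub>k\<close> for which \<open>p = \<surd>n\<close> and \<open>q = 1\<close> (\<open>john_biorthogonal_system\<close>). Then
  \<open>n = \<Sum> \<psi>\<^sub>k(x\<^sub>k) \<le> C\<^sup>2 \<surd>n \<parallel>Id\<parallel>\<close>, and \<open>C\<^sup>2 \<le> (\<pi> (1 + \<surd>2))\<^sup>2\<close>.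
\<close>


section \<open>Unimodular tensors of small injective norm\<close>

lemma cosh_le_exp_half_square: "cosh x \<le> exp (x\<^sup>2 / 2)" for x :: real
proof -
  have nonneg: "cosh x \<le> exp (x\<^sup>2 / 2)" if "0 \<le> x" for x :: real
  proof -
    have sinh: "sinh y \<le> y * cosh y" if "0 \<le> y" for y :: real
    proof -
      have "0 * cosh 0 - sinh 0 \<le> y * cosh y - sinh y"
      proof (rule DERIV_nonneg_imp_nondecreasing[OF that])
        fix t :: real
        assume "0 \<le> t"
        then show "\<exists>d. ((\<lambda>y. y * cosh y - sinh y) has_real_derivative d) (at t) \<and> 0 \<le> d"
          by (intro exI[of _ "t * sinh t"] conjI) (auto intro!: derivative_eq_intros)
      qed
      then show ?thesis by simp
    qed
    have "cosh x * exp (- x\<^sup>2 / 2) \<le> cosh 0 * exp (- 0\<^sup>2 / 2)"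
    proof (rule DERIV_nonpos_imp_nonincreasing[OF that])
      fix t :: real
      assume "0 \<le> t"
      then have "(sinh t - t * cosh t) * exp (- t\<^sup>2 / 2) \<le> 0"
        using sinh[of t] by (intro mult_nonpos_nonneg) auto
      then show "\<exists>d. ((\<lambda>y. cosh y * exp (- y\<^sup>2 / 2)) has_real_derivative d) (at t) \<and> d \<le> 0"
        by (intro exI[of _ "(sinh t - t * cosh t) * exp (- t\<^sup>2 / 2)"] conjI)
          (auto intro!: derivative_eq_intros simp: algebra_simps)
    qed
    then show ?thesis by (simp add: exp_minus field_simps)
  qed
  show ?thesis using nonneg[of x] nonneg[of "- x"] by (cases "0 \<le> x") simp_all
qed

text \<open>
  In coordinates rotated by \<open>\<pi>/4\<close> a uniform point of \<open>{1, i, -1, -i}\<close> is a pair of independent signs,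
  which is the factorization of \<open>cosh x + cosh y\<close> used below. Its real parts are therefore
  sub-Gaussian with half the variance of a random sign. With random signs in place of the phases the net
  argument below would double \<open>C\<^sup>2\<close> and exceed \<open>(\<pi> (1 + \<surd>2))\<^sup>2\<close>.
\<close>
lemma four_phase_mgf:
  fixes z :: complex
  shows "exp (Re z) + exp (Re (\<i> * z)) + exp (Re (- z)) + exp (Re (- (\<i> * z))) \<le> 4 * exp ((cmod z)\<^sup>2 / 4)"
proof -
  define x y where "x = Re z" and "y = Im z"
  have "exp (Re z) + exp (Re (\<i> * z)) + exp (Re (- z)) + exp (Re (- (\<i> * z))) = 2 * (cosh x + cosh y)"
    by (simp add: x_def y_def cosh_def field_simps)
  also have "cosh x + cosh y = 2 * (cosh ((x + y) / 2) * cosh ((x - y) / 2))"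
  proof -
    have "x = (x + y) / 2 + (x - y) / 2" "y = (x + y) / 2 - (x - y) / 2" by (simp_all add: field_simps)
    then show ?thesis using cosh_add[of "(x + y) / 2" "(x - y) / 2"] cosh_diff[of "(x + y) / 2" "(x - y) / 2"]
      by simp
  qed
  also have "cosh ((x + y) / 2) * cosh ((x - y) / 2) \<le> exp (((x + y) / 2)\<^sup>2 / 2) * exp (((x - y) / 2)\<^sup>2 / 2)"
    by (intro mult_mono cosh_le_exp_half_square) simp_all
  also have "\<dots> = exp ((cmod z)\<^sup>2 / 4)"
    by (simp add: cmod_def flip: exp_add x_def y_def) (simp add: power2_eq_square field_simps)
  finally show ?thesis by simp
qed

abbreviation phases :: "complex set" where "phases \<equiv> {1, \<i>, - 1, - \<i>}"

text \<open>
  The right-hand side bounds the average of the left-hand side over independent uniform phases.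
  Instead of a probability space, the phases are fixed one coordinate at a time, each time taking a value at
  which the sum is at most its average over the four values. The weights \<open>w\<close> carry the factors
  that belong to the coordinates already treated.
\<close>
lemma exists_phases_exp_le:
  fixes z :: "'p \<Rightarrow> 'i \<Rightarrow> complex" and w :: "'p \<Rightarrow> real"
  assumes "finite I" and w: "\<And>p. p \<in> P \<Longrightarrow> w p \<ge> 0"
  shows "\<exists>\<omega>. range \<omega> \<subseteq> phases \<and>
    (\<Sum>p\<in>P. w p * exp (Re (\<Sum>i\<in>I. \<omega> i * z p i))) \<le> (\<Sum>p\<in>P. w p * exp ((\<Sum>i\<in>I. (cmod (z p i))\<^sup>2) / 4))"
  using assms(1) w
proof (induction I arbitrary: w)
  case empty
  then show ?case by (intro exI[of _ "\<lambda>_. 1"]) simp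
next
  case (insert a I)
  define W where "W p = w p * exp ((cmod (z p a))\<^sup>2 / 4)" for p
  obtain \<omega> where \<omega>: "range \<omega> \<subseteq> phases"
    "(\<Sum>p\<in>P. W p * exp (Re (\<Sum>i\<in>I. \<omega> i * z p i))) \<le> (\<Sum>p\<in>P. W p * exp ((\<Sum>i\<in>I. (cmod (z p i))\<^sup>2) / 4))"
    using insert.IH[of W] insert.prems unfolding W_def by auto
  define v where "v p = w p * exp (Re (\<Sum>i\<in>I. \<omega> i * z p i))" for p
  define f where "f c = (\<Sum>p\<in>P. v p * exp (Re (c * z p a)))" for c
  have "f 1 + f \<i> + f (-1) + f (-\<i>) = (\<Sum>p\<in>P. v p * (exp (Re (z p a)) + exp (Re (\<i> * z p a)) + exp (Re (- z p a)) + exp (Re (- (\<i> * z p a)))))"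
    unfolding f_def by (simp add: sum.distrib distrib_left)
  also have "\<dots> \<le> (\<Sum>p\<in>P. v p * (4 * exp ((cmod (z p a))\<^sup>2 / 4)))"
    by (intro sum_mono mult_left_mono four_phase_mgf) (simp add: v_def insert.prems)
  also have "\<dots> = 4 * (\<Sum>p\<in>P. W p * exp (Re (\<Sum>i\<in>I. \<omega> i * z p i)))"
    by (simp add: v_def W_def sum_distrib_left mult_ac)
  finally have "\<exists>c\<in>phases. f c \<le> (\<Sum>p\<in>P. W p * exp (Re (\<Sum>i\<in>I. \<omega> i * z p i)))"
    by (rule_tac ccontr) simp
  then obtain c where c: "c \<in> phases" "f c \<le> (\<Sum>p\<in>P. W p * exp (Re (\<Sum>i\<in>I. \<omega> i * z p i)))"
    by blast
  define \<omega>' where "\<omega>' = fun_upd \<omega> a c"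
  have "(\<Sum>i\<in>insert a I. \<omega>' i * z p i) = c * z p a + (\<Sum>i\<in>I. \<omega> i * z p i)" for p
    using insert.hyps by (simp add: \<omega>'_def, intro sum.cong) auto
  then have "(\<Sum>p\<in>P. w p * exp (Re (\<Sum>i\<in>insert a I. \<omega>' i * z p i))) = f c"
    by (simp add: f_def v_def exp_add mult_ac)
  also have "f c \<le> (\<Sum>p\<in>P. W p * exp ((\<Sum>i\<in>I. (cmod (z p i))\<^sup>2) / 4))"
    using c(2) \<omega>(2) by linarith
  also have "\<dots> = (\<Sum>p\<in>P. w p * exp ((\<Sum>i\<in>insert a I. (cmod (z p i))\<^sup>2) / 4))"
    using insert.hyps by (simp add: W_def exp_add add_divide_distrib mult_ac)
  finally show ?case
    using \<omega>(1) c(1) by (intro exI[of _ \<omega>']) (auto simp: \<omega>'_def)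
qed

lemma geometric_sum_two_sided:
  "(\<Sum>k\<in>{- int B..int B}. (10 / 11 :: real) ^ nat \<bar>k\<bar>) \<le> 21"
proof -
  have "(\<Sum>k\<in>{- int B..int B}. (10 / 11 :: real) ^ nat \<bar>k\<bar>) = 21 - 20 * (10 / 11) ^ B"
  proof (induction B)
    case (Suc B)
    have "{- int (Suc B)..int (Suc B)} = insert (int (Suc B)) (insert (- int (Suc B)) {- int B..int B})"
      by auto
    then show ?case by (simp add: Suc.IH nat_add_distrib)
  qed simp
  then show ?thesis by simp
qed

text \<open>
  Weight the integer vectors by \<open>(10/11)\<^bsup>\<Sum>|z\<^sub>j|\<^esup>\<close>. On the set that is counted the weight is at least
  \<open>(10/11)\<^bsup>10 card J\<^esup>\<close>, and the total weight factorizes over the coordinates. The ratio \<open>10/11\<close> is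
  nearly optimal for radius \<open>10 card J\<close>; the resulting base is \<open>21 (11/10)\<^bsup>10\<^esup> < 55\<close>.
\<close>
lemma card_l1_ball_le:
  assumes J: "finite J"
  shows "real (card {z \<in> J \<rightarrow>\<^sub>E {- int B..int B}. (\<Sum>j\<in>J. \<bar>z j\<bar>) \<le> 10 * int (card J)}) \<le> 55 ^ card J"
    (is "real (card ?Z) \<le> _")
proof -
  have fin: "finite (J \<rightarrow>\<^sub>E {- int B..int B})" using J by (intro finite_PiE) auto
  have "(10 / 11 :: real) ^ (10 * card J) * card ?Z = (\<Sum>z\<in>?Z. (10 / 11) ^ (10 * card J))"
    by simp
  also have "\<dots> \<le> (\<Sum>z\<in>?Z. \<Prod>j\<in>J. (10 / 11) ^ nat \<bar>z j\<bar>)"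
  proof (rule sum_mono)
    fix z assume z: "z \<in> ?Z"
    have "int (\<Sum>j\<in>J. nat \<bar>z j\<bar>) \<le> int (10 * card J)" using z by simp
    then have "(\<Sum>j\<in>J. nat \<bar>z j\<bar>) \<le> 10 * card J" by (rule iffD1[OF of_nat_le_iff])
    then show "(10 / 11 :: real) ^ (10 * card J) \<le> (\<Prod>j\<in>J. (10 / 11) ^ nat \<bar>z j\<bar>)"
      by (simp add: power_decreasing flip: power_sum)
  qed
  also have "\<dots> \<le> (\<Sum>z\<in>J \<rightarrow>\<^sub>E {- int B..int B}. \<Prod>j\<in>J. (10 / 11) ^ nat \<bar>z j\<bar>)"
    using fin by (intro sum_mono2) (auto intro!: prod_nonneg)
  also have "\<dots> = (\<Prod>j\<in>J. \<Sum>k\<in>{- int B..int B}. (10 / 11) ^ nat \<bar>k\<bar>)"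
    by (subst prod_sum_PiE) (use J in auto)
  also have "\<dots> \<le> (\<Prod>j\<in>J. 21)"
    by (intro prod_mono conjI sum_nonneg geometric_sum_two_sided) simp
  finally have "(10 / 11 :: real) ^ (10 * card J) * card ?Z \<le> 21 ^ card J" by simp
  then have "((10 / 11 :: real) ^ 10) ^ card J * card ?Z \<le> 21 ^ card J"
    by (simp add: power_mult)
  then have "real (card ?Z) \<le> 21 ^ card J / ((10 / 11) ^ 10) ^ card J"
    by (simp add: field_simps)
  also have "\<dots> = (21 / (10 / 11) ^ 10) ^ card J" by (rule power_divide[symmetric])
  also have "\<dots> \<le> 55 ^ card J" by (intro power_mono) (simp_all add: power_divide)
  finally show ?thesis .
qed

abbreviation cl2 :: "nat \<Rightarrow> (nat \<Rightarrow> complex) \<Rightarrow> real" where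
  "cl2 n a \<equiv> L2_set (\<lambda>i. cmod (a i)) {..<n}"

lemma cl2_square: "(cl2 n a)\<^sup>2 = (\<Sum>i<n. (cmod (a i))\<^sup>2)"
  by (simp add: L2_set_def sum_nonneg)

lemma cl2_scale: "cl2 n (\<lambda>i. c * a i) = cmod c * cl2 n a"
  by (simp add: norm_mult L2_set_right_distrib)

lemma cl2_eq_0: "cl2 n a = 0 \<Longrightarrow> i < n \<Longrightarrow> a i = 0"
  by (simp add: L2_set_eq_0_iff)

lemma round_towards_zero:
  fixes t :: real
  shows "\<exists>z::int. \<bar>of_int z\<bar> \<le> \<bar>t\<bar> \<and> \<bar>t - of_int z\<bar> \<le> 1"
proof (cases "t \<ge> 0")
  case True
  then have "0 \<le> real_of_int \<lfloor>t\<rfloor>" by simp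
  with True show ?thesis by (intro exI[of _ "\<lfloor>t\<rfloor>"]) linarith
next
  case False
  then have "real_of_int \<lceil>t\<rceil> \<le> 0" by simp
  with False show ?thesis by (intro exI[of _ "\<lceil>t\<rceil>"]) linarith
qed

text \<open>
  Rounding towards zero never increases an absolute value, so the rounded vector stays in the unit
  ball. The mesh is chosen such that an error of at most \<open>h\<close> in every coordinate amounts to \<open>1/10\<close> in \<open>\<ell>\<^sub>2\<close>, and the
  Cauchy-Schwarz inequality then puts the integer vector into the \<open>\<ell>\<^sub>1\<close> ball counted above.
\<close>
lemma exists_grid_point:
  fixes r :: "'j \<Rightarrow> real"
  assumes J: "finite J" "J \<noteq> {}" and r: "L2_set r J \<le> 1"
  defines "h \<equiv> 1 / (10 * sqrt (card J))"
  shows "\<exists>z \<in> J \<rightarrow>\<^sub>E {- int (10 * card J)..int (10 * card J)}. (\<Sum>j\<in>J. \<bar>z j\<bar>) \<le> 10 * int (card J)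
    \<and> (\<forall>j\<in>J. \<bar>h * of_int (z j)\<bar> \<le> \<bar>r j\<bar> \<and> \<bar>r j - h * of_int (z j)\<bar> \<le> h)"
proof -
  have cJ: "card J > 0" using J by (simp add: card_gt_0_iff)
  then have h: "h > 0" by (simp add: h_def)
  obtain \<zeta> :: "'j \<Rightarrow> int" where \<zeta>: "\<bar>of_int (\<zeta> j)\<bar> \<le> \<bar>r j / h\<bar>" "\<bar>r j / h - of_int (\<zeta> j)\<bar> \<le> 1" for j
    using round_towards_zero[of "r _ / h"] by metis
  define z where "z = restrict \<zeta> J"
  have le: "\<bar>h * of_int (z j)\<bar> \<le> \<bar>r j\<bar> \<and> \<bar>r j - h * of_int (z j)\<bar> \<le> h" if "j \<in> J" for j
  proof
    show "\<bar>h * of_int (z j)\<bar> \<le> \<bar>r j\<bar>"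
      using \<zeta>(1)[of j] h that by (simp add: z_def abs_mult field_simps)
    have "\<bar>r j - h * of_int (z j)\<bar> = h * \<bar>r j / h - of_int (\<zeta> j)\<bar>"
      using h that by (simp add: z_def abs_mult_pos' field_simps flip: abs_mult_pos)
    also have "\<dots> \<le> h * 1" using \<zeta>(2)[of j] h by (intro mult_left_mono) auto
    finally show "\<bar>r j - h * of_int (z j)\<bar> \<le> h" by simp
  qed
  have "h * (\<Sum>j\<in>J. \<bar>of_int (z j)\<bar>) \<le> (\<Sum>j\<in>J. \<bar>r j\<bar> * \<bar>1\<bar>)"
    unfolding sum_distrib_left using le h by (intro sum_mono) (auto simp: abs_mult)
  also have "\<dots> \<le> L2_set r J * L2_set (\<lambda>_. 1) J"
    by (rule L2_set_mult_ineq)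
  also have "\<dots> \<le> 1 * sqrt (card J)"
    using r by (intro mult_mono) (auto simp: L2_set_def)
  finally have "(\<Sum>j\<in>J. \<bar>of_int (z j)\<bar>) \<le> sqrt (card J) / h"
    using h by (simp add: field_simps)
  also have "sqrt (card J) / h = 10 * real (card J)" by (simp add: h_def)
  finally have "of_int (\<Sum>j\<in>J. \<bar>z j\<bar>) \<le> (of_int (10 * int (card J)) :: real)" by simp
  then have s: "(\<Sum>j\<in>J. \<bar>z j\<bar>) \<le> 10 * int (card J)" by (rule iffD1[OF of_int_le_iff])
  have "\<bar>z j\<bar> \<le> 10 * int (card J)" if "j \<in> J" for j
    using member_le_sum[OF that, of "\<lambda>j. \<bar>z j\<bar>"] s J by simp
  then have "z \<in> J \<rightarrow>\<^sub>E {- int (10 * card J)..int (10 * card J)}"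
    by (fastforce simp: z_def abs_le_iff)
  with s le show ?thesis by blast
qed

lemma L2_set_Re_Im: "L2_set (\<lambda>(i, s). if s then Im (a i) else Re (a i)) ({..<n} \<times> UNIV) = cl2 n a"
  by (simp add: L2_set_def UNIV_bool cmod_power2 add.commute sum.cartesian_product')

text \<open>
  The grid of the preceding lemmas for the \<open>2 n\<close> real and imaginary parts, cut down to the unit
  ball.
\<close>
lemma exists_net:
  assumes n: "n > 0"
  obtains G :: "(nat \<Rightarrow> complex) set" where "finite G" "real (card G) \<le> 55 ^ (2 * n)"
    "\<And>a. a \<in> G \<Longrightarrow> cl2 n a \<le> 1"
    "\<And>a. cl2 n a \<le> 1 \<Longrightarrow> \<exists>b\<in>G. cl2 n (\<lambda>i. a i - b i) \<le> 1 / 10"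
proof -
  define J :: "(nat \<times> bool) set" where "J = {..<n} \<times> UNIV"
  have cJ: "card J = 2 * n" and J: "finite J" "J \<noteq> {}"
    using n by (auto simp: J_def card_cartesian_product)
  define h where "h = 1 / (10 * sqrt (card J))"
  have h: "h \<ge> 0" by (simp add: h_def)
  define Z where "Z = {z \<in> J \<rightarrow>\<^sub>E {- int (10 * card J)..int (10 * card J)}. (\<Sum>j\<in>J. \<bar>z j\<bar>) \<le> 10 * int (card J)}"
  define p where "p z i = Complex (h * of_int (z (i, False))) (h * of_int (z (i, True)))" for z :: "nat \<times> bool \<Rightarrow> int" and i
  define G where "G = {a \<in> p ` Z. cl2 n a \<le> 1}"
  have fZ: "finite Z" unfolding Z_def using J by (intro finite_subset[OF _ finite_PiE[of J "\<lambda>_. {- int (10 * card J)..int (10 * card J)}"]]) auto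
  show ?thesis
  proof (rule that[of G])
    show "finite G" using fZ by (simp add: G_def)
    have "card G \<le> card (p ` Z)" using fZ by (intro card_mono) (auto simp: G_def)
    also have "\<dots> \<le> card Z" by (rule card_image_le[OF fZ])
    finally have "real (card G) \<le> real (card Z)" by simp
    also have "\<dots> \<le> 55 ^ card J" unfolding Z_def by (rule card_l1_ball_le[OF J(1)])
    finally show "real (card G) \<le> 55 ^ (2 * n)" by (simp add: cJ)
    show "cl2 n a \<le> 1" if "a \<in> G" for a using that by (simp add: G_def)
    fix a assume a: "cl2 n a \<le> 1"
    define r where "r = (\<lambda>(i, s). if s then Im (a i) else Re (a i))"
    have "L2_set r J \<le> 1" using a by (simp add: r_def J_def L2_set_Re_Im)
    from exists_grid_point[OF J this] obtain z where z: "z \<in> Z"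
      "\<And>j. j \<in> J \<Longrightarrow> \<bar>h * of_int (z j)\<bar> \<le> \<bar>r j\<bar> \<and> \<bar>r j - h * of_int (z j)\<bar> \<le> h"
      unfolding Z_def h_def by blast
    have "cl2 n (p z) = L2_set (\<lambda>j. h * of_int (z j)) J"
      unfolding J_def L2_set_Re_Im[symmetric] by (intro L2_set_cong) (auto simp: p_def)
    also have "\<dots> = L2_set (\<lambda>j. \<bar>h * of_int (z j)\<bar>) J" by (simp add: L2_set_def)
    also have "\<dots> \<le> L2_set (\<lambda>j. \<bar>r j\<bar>) J" using z by (intro L2_set_mono) auto
    also have "\<dots> = cl2 n a" unfolding J_def r_def L2_set_Re_Im[symmetric] by (simp add: L2_set_def)
    finally have "p z \<in> G" using a z by (auto simp: G_def)
    have "cl2 n (\<lambda>i. a i - p z i) = L2_set (\<lambda>j. r j - h * of_int (z j)) J"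
      unfolding J_def L2_set_Re_Im[symmetric] by (intro L2_set_cong) (auto simp: p_def r_def)
    also have "\<dots> = L2_set (\<lambda>j. \<bar>r j - h * of_int (z j)\<bar>) J" by (simp add: L2_set_def)
    also have "\<dots> \<le> L2_set (\<lambda>j. h) J" using z by (intro L2_set_mono) auto
    also have "\<dots> = 1 / 10" using n h by (simp add: L2_set_def real_sqrt_mult cJ) (simp add: h_def cJ real_sqrt_mult)
    finally show "\<exists>b\<in>G. cl2 n (\<lambda>i. a i - b i) \<le> 1 / 10" using \<open>p z \<in> G\<close> by blast
  qed
qed

definition trilinear :: "nat \<Rightarrow> (nat \<Rightarrow> nat \<Rightarrow> nat \<Rightarrow> complex) \<Rightarrow>
    (nat \<Rightarrow> complex) \<Rightarrow> (nat \<Rightarrow> complex) \<Rightarrow> (nat \<Rightarrow> complex) \<Rightarrow> complex" where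
  "trilinear n t a b c = (\<Sum>k<n. \<Sum>i<n. \<Sum>j<n. t k i j * a k * b i * c j)"

lemma trilinear_diff:
  "trilinear n t (\<lambda>k. a k - a' k) b c = trilinear n t a b c - trilinear n t a' b c"
  "trilinear n t a (\<lambda>k. b k - b' k) c = trilinear n t a b c - trilinear n t a b' c"
  "trilinear n t a b (\<lambda>k. c k - c' k) = trilinear n t a b c - trilinear n t a b c'"
  unfolding trilinear_def sum_subtractf[symmetric] by (intro sum.cong refl; simp add: algebra_simps)+

lemma trilinear_scale:
  "trilinear n t (\<lambda>k. s * a k) b c = s * trilinear n t a b c"
  "trilinear n t a (\<lambda>k. s * b k) c = s * trilinear n t a b c"
  "trilinear n t a b (\<lambda>k. s * c k) = s * trilinear n t a b c"
  unfolding trilinear_def sum_distrib_left by (intro sum.cong refl; simp add: algebra_simps)+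

lemma trilinear_homogeneous_bound:
  assumes "\<And>a b c. cl2 n a \<le> 1 \<Longrightarrow> cl2 n b \<le> 1 \<Longrightarrow> cl2 n c \<le> 1 \<Longrightarrow> cmod (trilinear n t a b c) \<le> M"
  shows "cmod (trilinear n t a b c) \<le> M * cl2 n a * cl2 n b * cl2 n c"
proof (cases "cl2 n a = 0 \<or> cl2 n b = 0 \<or> cl2 n c = 0")
  case True
  then have "trilinear n t a b c = 0"
    using cl2_eq_0 unfolding trilinear_def by (intro sum.neutral ballI) auto
  with True show ?thesis by auto
next
  case False
  let ?A = "inverse (complex_of_real (cl2 n a))" and ?B = "inverse (complex_of_real (cl2 n b))"
    and ?C = "inverse (complex_of_real (cl2 n c))"
  have pos: "cl2 n a > 0" "cl2 n b > 0" "cl2 n c > 0" using False L2_set_nonneg by (metis less_eq_real_def)+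
  have "cmod (trilinear n t (\<lambda>k. ?A * a k) (\<lambda>k. ?B * b k) (\<lambda>k. ?C * c k)) \<le> M"
    using False by (intro assms; simp add: cl2_scale norm_inverse)
  then have "inverse (cl2 n a) * (inverse (cl2 n b) * (inverse (cl2 n c) * cmod (trilinear n t a b c))) \<le> M"
    using False by (simp add: trilinear_scale norm_mult norm_inverse)
  with pos show ?thesis by (simp add: field_simps)
qed

lemma trilinear_crude_bound:
  assumes t: "\<And>k i j. cmod (t k i j) \<le> 1" and "cl2 n a \<le> 1" "cl2 n b \<le> 1" "cl2 n c \<le> 1"
  shows "cmod (trilinear n t a b c) \<le> real n ^ 3"
proof -
  have le: "cmod (x i) \<le> 1" if "cl2 n x \<le> 1" "i < n" for x i
    using member_le_L2_set[of "{..<n}" i "\<lambda>i. cmod (x i)"] that by simp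
  have "cmod (trilinear n t a b c) \<le> (\<Sum>k<n. \<Sum>i<n. \<Sum>j<n. 1 * 1 * 1 * 1)"
    unfolding trilinear_def
    by (intro order_trans[OF norm_sum] sum_mono, unfold norm_mult, intro mult_mono)
      (simp_all add: le assms)
  then show ?thesis by (simp add: power3_eq_cube)
qed

text \<open>
  For the three factors together the net has at most \<open>55\<^bsup>6n\<^esup> \<le> e\<^bsup>25n\<^esup>\<close> points. On each of them the
  form is sub-Gaussian, so for suitable phases its real part is at most \<open>25n/l + l/4\<close> at every
  point of the net, for any \<open>l > 0\<close>; the best choice \<open>l = 10 \<surd>n\<close> gives \<open>5 \<surd>n\<close>. Replacing an arbitrary triple of
  unit vectors by a triple of net points changes the form by at most \<open>3/10\<close> of its norm \<open>M\<close>, whence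
  \<open>M \<le> 5 \<surd>n + 3 M / 10\<close>.
\<close>
lemma exists_phase_tensor:
  "\<exists>\<omega>. (\<forall>k i j. \<omega> k i j \<in> phases) \<and>
    (\<forall>a b c. cmod (trilinear n \<omega> a b c) \<le> 50 / 7 * sqrt n * cl2 n a * cl2 n b * cl2 n c)"
proof (cases "n = 0")
  case True
  then show ?thesis by (intro exI[of _ "\<lambda>_ _ _. 1"]) (simp add: trilinear_def)
next
  case False
  then have n: "n > 0" by simp
  obtain G where G: "finite G" "real (card G) \<le> 55 ^ (2 * n)" "\<And>a. a \<in> G \<Longrightarrow> cl2 n a \<le> 1"
    "\<And>a. cl2 n a \<le> 1 \<Longrightarrow> \<exists>b\<in>G. cl2 n (\<lambda>i. a i - b i) \<le> 1 / 10"
    by (rule exists_net[OF n]) (rule that, assumption+)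
  define l where "l = 10 * sqrt n"
  define P where "P = G \<times> G \<times> G"
  define I where "I = {..<n} \<times> {..<n} \<times> {..<n}"
  define z where "z = (\<lambda>(a :: nat \<Rightarrow> complex, b :: nat \<Rightarrow> complex, c :: nat \<Rightarrow> complex) (k :: nat, i :: nat, j :: nat).
    complex_of_real l * (a k * b i * c j))"
  have "finite I" by (simp add: I_def)
  then obtain w where w: "range w \<subseteq> phases"
    "(\<Sum>p\<in>P. 1 * exp (Re (\<Sum>i\<in>I. w i * z p i))) \<le> (\<Sum>p\<in>P. 1 * exp ((\<Sum>i\<in>I. (cmod (z p i))\<^sup>2) / 4))"
    using exists_phases_exp_le[of I P "\<lambda>_. 1" z] by auto
  define \<omega> where "\<omega> k i j = w (k, i, j)" for k i j
  have \<omega>: "\<omega> k i j \<in> phases" for k i j using w(1) by (auto simp: \<omega>_def)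
  have \<omega>1: "cmod (\<omega> k i j) \<le> 1" for k i j using \<omega>[of k i j] by auto
  have net: "Re (trilinear n \<omega> a b c) \<le> 5 * sqrt n" if abc: "a \<in> G" "b \<in> G" "c \<in> G" for a b c
  proof -
    have "exp (l * Re (trilinear n \<omega> a b c)) = exp (Re (\<Sum>i\<in>I. w i * z (a, b, c) i))"
      by (simp add: trilinear_def z_def I_def \<omega>_def sum.cartesian_product' sum_distrib_left algebra_simps)
    also have "\<dots> \<le> (\<Sum>p\<in>P. exp (Re (\<Sum>i\<in>I. w i * z p i)))"
      using abc G(1) by (intro member_le_sum) (auto simp: P_def)
    also have "\<dots> \<le> (\<Sum>p\<in>P. exp ((\<Sum>i\<in>I. (cmod (z p i))\<^sup>2) / 4))" using w(2) by simp
    also have "\<dots> \<le> (\<Sum>p\<in>P. exp (25 * n))"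
    proof (intro sum_mono, clarsimp simp: P_def)
      fix a b c assume "a \<in> G" "b \<in> G" "c \<in> G"
      then have 1: "(cl2 n a)\<^sup>2 \<le> 1" "(cl2 n b)\<^sup>2 \<le> 1" "(cl2 n c)\<^sup>2 \<le> 1" using G(3) by (simp_all add: power_le_one)
      have "(\<Sum>i\<in>I. (cmod (z (a, b, c) i))\<^sup>2) = l\<^sup>2 * ((cl2 n a)\<^sup>2 * ((cl2 n b)\<^sup>2 * (cl2 n c)\<^sup>2))"
        unfolding cl2_square sum_product
        by (simp add: z_def I_def sum.cartesian_product' sum_distrib_left norm_mult power_mult_distrib mult_ac)
      also have "\<dots> \<le> l\<^sup>2 * (1 * (1 * 1))"
        using 1 by (intro mult_left_mono mult_mono) auto
      finally show "(\<Sum>i\<in>I. (cmod (z (a, b, c) i))\<^sup>2) \<le> 100 * real n"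
        by (simp add: l_def power_mult_distrib)
    qed
    also have "\<dots> = real (card G) * real (card G) * real (card G) * exp (25 * n)" by (simp add: P_def card_cartesian_product mult_ac)
    also have "\<dots> \<le> 55 ^ (2 * n) * 55 ^ (2 * n) * 55 ^ (2 * n) * exp (25 * n)"
      by (intro mult_right_mono mult_mono G(2)) auto
    also have "\<dots> = (55 ^ 6) ^ n * exp (25 * n)"
      by (simp only: mult_2 power_add[symmetric] power_mult[symmetric]) (simp add: algebra_simps)
    also have "\<dots> \<le> (exp 25) ^ n * exp (25 * n)"
    proof (intro mult_right_mono power_mono)
      have "(55 ^ 6 :: real) \<le> (2.7 :: real) ^ 25" by (simp add: field_simps)
      also have "\<dots> \<le> exp 1 ^ 25" using e_approx_32 by (intro power_mono) (auto simp: abs_if split: if_splits)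
      also have "\<dots> = exp 25" by (simp flip: exp_of_nat_mult)
      finally show "55 ^ 6 \<le> exp (25 :: real)" .
    qed auto
    also have "\<dots> = exp (50 * n)" by (simp flip: exp_of_nat_mult exp_add)
    finally have "l * Re (trilinear n \<omega> a b c) \<le> l * (5 * sqrt n)" by (simp add: l_def)
    moreover have "l > 0" using n by (simp add: l_def)
    ultimately show ?thesis by (rule mult_left_le_imp_le)
  qed
  define B where "B = {(a, b, c). cl2 n a \<le> 1 \<and> cl2 n b \<le> 1 \<and> cl2 n c \<le> 1}"
  define M where "M = (SUP (a, b, c)\<in>B. cmod (trilinear n \<omega> a b c))"
  (* A finite norm M is needed before it can be absorbed into the left-hand side. *)
  have bdd: "bdd_above ((\<lambda>(a, b, c). cmod (trilinear n \<omega> a b c)) ` B)"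
    using trilinear_crude_bound[OF \<omega>1] by (intro bdd_aboveI[of _ "real n ^ 3"]) (auto simp: B_def)
  have M: "cmod (trilinear n \<omega> a b c) \<le> M" if "cl2 n a \<le> 1" "cl2 n b \<le> 1" "cl2 n c \<le> 1" for a b c
    unfolding M_def using cSUP_upper[OF _ bdd, of "(a, b, c)"] that by (simp add: B_def)
  have M0: "0 \<le> M" using order_trans[OF norm_ge_zero M[of "\<lambda>_. 0" "\<lambda>_. 0" "\<lambda>_. 0"]] by (simp add: L2_set_def)
  have improve: "Re (trilinear n \<omega> a b c) \<le> 5 * sqrt n + 3 / 10 * M"
    if abc: "cl2 n a \<le> 1" "cl2 n b \<le> 1" "cl2 n c \<le> 1" for a b c
  proof -
    obtain a' b' c' where G': "a' \<in> G" "b' \<in> G" "c' \<in> G" "cl2 n (\<lambda>i. a i - a' i) \<le> 1 / 10"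
      "cl2 n (\<lambda>i. b i - b' i) \<le> 1 / 10" "cl2 n (\<lambda>i. c i - c' i) \<le> 1 / 10"
      using G(4) abc by meson
    have small: "Re (trilinear n \<omega> x y u) \<le> M / 10"
      if "cl2 n x * cl2 n y * cl2 n u \<le> 1 / 10" for x y u
    proof -
      have "Re (trilinear n \<omega> x y u) \<le> M * cl2 n x * cl2 n y * cl2 n u"
        using trilinear_homogeneous_bound[of n \<omega> M, OF M] complex_Re_le_cmod order_trans by blast
      also have "\<dots> = M * (cl2 n x * cl2 n y * cl2 n u)" by simp
      also have "\<dots> \<le> M * (1 / 10)" using that M0 by (rule mult_left_mono)
      finally show ?thesis by simp
    qed
    have "cl2 n (\<lambda>i. a i - a' i) * cl2 n b * cl2 n c \<le> 1 / 10 * 1 * 1"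
      "cl2 n a' * cl2 n (\<lambda>i. b i - b' i) * cl2 n c \<le> 1 * (1 / 10) * 1"
      "cl2 n a' * cl2 n b' * cl2 n (\<lambda>i. c i - c' i) \<le> 1 * 1 * (1 / 10)"
      using G' abc G(3) by (intro mult_mono; simp)+
    then have "Re (trilinear n \<omega> (\<lambda>i. a i - a' i) b c) \<le> M / 10"
      "Re (trilinear n \<omega> a' (\<lambda>i. b i - b' i) c) \<le> M / 10"
      "Re (trilinear n \<omega> a' b' (\<lambda>i. c i - c' i)) \<le> M / 10"
      by (intro small; simp)+
    with net[OF G'(1-3)] show ?thesis by (simp add: trilinear_diff)
  qed
  have "M \<le> 5 * sqrt n + 3 / 10 * M"
    unfolding M_def
  proof (rule cSUP_least)
    have "(\<lambda>_. 0, \<lambda>_. 0, \<lambda>_. 0) \<in> B" by (simp add: B_def L2_set_def)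
    then show "B \<noteq> {}" by blast
    fix p assume "p \<in> B"
    then obtain a b c where p: "p = (a, b, c)" "cl2 n a \<le> 1" "cl2 n b \<le> 1" "cl2 n c \<le> 1"
      by (auto simp: B_def)
    define F where "F = trilinear n \<omega> a b c"
    (* Rotating the first argument turns the modulus into a real part. *)
    define s where "s = (if F = 0 then 1 else cnj (sgn F))"
    have s: "cmod s = 1" "s * F = cmod F"
      by (auto simp: s_def norm_divide sgn_eq complex_norm_square[symmetric] power2_eq_square field_simps)
    have "cmod F = Re (trilinear n \<omega> (\<lambda>k. s * a k) b c)"
      unfolding trilinear_scale F_def[symmetric] s by simp
    also have "\<dots> \<le> 5 * sqrt n + 3 / 10 * M"
      using p by (intro improve) (simp_all add: cl2_scale s)
    finally show "(case p of (a, b, c) \<Rightarrow> cmod (trilinear n \<omega> a b c)) \<le> 5 * sqrt n + 3 / 10 * (SUP (a, b, c)\<in>B. cmod (trilinear n \<omega> a b c))"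
      by (simp add: p F_def M_def)
  qed
  then have "M \<le> 50 / 7 * sqrt n" by simp
  then have "cmod (trilinear n \<omega> a b c) \<le> 50 / 7 * sqrt n * cl2 n a * cl2 n b * cl2 n c" for a b c
    by (intro trilinear_homogeneous_bound order_trans[OF M])
  with \<omega> show ?thesis by blast
qed

section \<open>Minimal and maximal matrix norms\<close>

text \<open>
  For independent random signs the right-hand sum has mean \<open>\<Sum> c\<^sub>r\<^sub>r\<close>, so some choice of signs is at least
  as large in modulus. In the induction the last sign enters only through \<open>Q \<plusminus> L\<close>, where \<open>Q\<close> is the
  part without it; one of these two numbers has modulus at least \<open>|Q|\<close>. The constant \<open>c0\<close> absorbs the diagonal entry that
  is split off.
\<close>
lemma exists_signs_diagonal_le:
  fixes c :: "nat \<Rightarrow> nat \<Rightarrow> complex"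
  shows "\<exists>\<epsilon>::nat \<Rightarrow> complex. range \<epsilon> \<subseteq> {1, -1} \<and>
    cmod (c0 + (\<Sum>r<d. c r r)) \<le> cmod (c0 + (\<Sum>r<d. \<Sum>s<d. \<epsilon> r * \<epsilon> s * c r s))"
proof (induction d arbitrary: c0)
  case 0
  show ?case by (intro exI[of _ "\<lambda>_. 1"]) simp
next
  case (Suc d)
  obtain \<epsilon> :: "nat \<Rightarrow> complex" where \<epsilon>: "range \<epsilon> \<subseteq> {1, -1}"
    "cmod (c0 + c d d + (\<Sum>r<d. c r r)) \<le> cmod (c0 + c d d + (\<Sum>r<d. \<Sum>s<d. \<epsilon> r * \<epsilon> s * c r s))"
    using Suc.IH[of "c0 + c d d"] by blast
  define Q where "Q = c0 + c d d + (\<Sum>r<d. \<Sum>s<d. \<epsilon> r * \<epsilon> s * c r s)"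
  define L where "L = (\<Sum>s<d. \<epsilon> s * c d s) + (\<Sum>r<d. \<epsilon> r * c r d)"
  have "2 * cmod Q \<le> cmod (Q + L) + cmod (Q - L)"
    using norm_triangle_ineq[of "Q + L" "Q - L"] by (simp flip: mult_2 add: norm_mult)
  then have "\<exists>\<sigma>\<in>{1, -1::complex}. cmod Q \<le> cmod (Q + \<sigma> * L)"
    by (rule_tac ccontr) simp
  then obtain \<sigma> :: complex where \<sigma>: "\<sigma> \<in> {1, -1}" "cmod Q \<le> cmod (Q + \<sigma> * L)" by blast
  define \<epsilon>' where "\<epsilon>' = fun_upd \<epsilon> d \<sigma>"
  have "c0 + (\<Sum>r<Suc d. \<Sum>s<Suc d. \<epsilon>' r * \<epsilon>' s * c r s) = Q + \<sigma> * L"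
    using \<sigma>(1) by (auto simp: \<epsilon>'_def Q_def L_def sum.distrib sum_distrib_left algebra_simps)
  moreover have "c0 + (\<Sum>r<Suc d. c r r) = c0 + c d d + (\<Sum>r<d. c r r)" by simp
  ultimately have "cmod (c0 + (\<Sum>r<Suc d. c r r)) \<le> cmod (c0 + (\<Sum>r<Suc d. \<Sum>s<Suc d. \<epsilon>' r * \<epsilon>' s * c r s))"
    using \<epsilon>(2) \<sigma>(2) by (simp only: Q_def)
  moreover have "range \<epsilon>' \<subseteq> {1, -1}" using \<epsilon>(1) \<sigma>(1) by (auto simp: \<epsilon>'_def)
  ultimately show ?case by blast
qed

lemma cl2_le_if_pairing_le:
  assumes "\<And>a. cmod (\<Sum>k<n. a k * z k) \<le> K * cl2 n a" and "K \<ge> 0"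
  shows "cl2 n z \<le> K"
proof (cases "cl2 n z = 0")
  case False
  have "cl2 n z * cl2 n z = cmod (\<Sum>k<n. cnj (z k) * z k)"
  proof -
    have "(\<Sum>k<n. cnj (z k) * z k) = of_real ((cl2 n z)\<^sup>2)"
      unfolding cl2_square by (simp add: complex_norm_square mult.commute del: of_real_power)
    then show ?thesis by (simp only: norm_of_real) (simp add: power2_eq_square)
  qed
  also have "\<dots> \<le> K * cl2 n z" using assms(1)[of "\<lambda>k. cnj (z k)"] by simp
  finally show ?thesis using False L2_set_nonneg[of "\<lambda>k. cmod (z k)" "{..<n}"] by (simp add: mult_le_cancel_right)
qed (use assms in simp)

lemma mat_norm_le:
  assumes "\<And>\<xi> \<eta>. cmod (\<Sum>i<n. \<Sum>j<n. A i j * \<eta> i * \<xi> j) \<le> K * cl2 n \<eta> * cl2 n \<xi>" and "K \<ge> 0"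
  shows "mat_norm {..<n} A \<le> ennreal K"
  unfolding mat_norm_def
proof (intro SUP_least ennreal_leI, clarify)
  fix \<xi> :: "nat \<Rightarrow> complex" assume \<xi>: "cl2 n \<xi> \<le> 1"
  have "cl2 n (\<lambda>i. \<Sum>j<n. A i j * \<xi> j) \<le> K * cl2 n \<xi>"
  proof (rule cl2_le_if_pairing_le)
    fix \<eta>
    have "(\<Sum>k<n. \<eta> k * (\<Sum>j<n. A k j * \<xi> j)) = (\<Sum>i<n. \<Sum>j<n. A i j * \<eta> i * \<xi> j)"
      by (simp add: sum_distrib_left mult_ac)
    then show "cmod (\<Sum>k<n. \<eta> k * (\<Sum>j<n. A k j * \<xi> j)) \<le> K * cl2 n \<xi> * cl2 n \<eta>"
      using assms(1)[of \<eta> \<xi>] by (simp add: mult_ac)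
  qed (use assms in simp)
  also have "\<dots> \<le> K * 1" using \<xi> assms(2) by (intro mult_left_mono)
  finally show "cl2 n (\<lambda>i. \<Sum>j<n. A i j * \<xi> j) \<le> K" by simp
qed

lemma mat_norm_ge:
  assumes "L2_set (\<lambda>i. cmod (\<eta> i)) I \<le> 1" "L2_set (\<lambda>j. cmod (\<xi> j)) I \<le> 1"
  shows "ennreal (cmod (\<Sum>i\<in>I. \<Sum>j\<in>I. A i j * \<eta> i * \<xi> j)) \<le> mat_norm I A"
proof -
  have "cmod (\<Sum>i\<in>I. \<Sum>j\<in>I. A i j * \<eta> i * \<xi> j) = cmod (\<Sum>i\<in>I. \<eta> i * (\<Sum>j\<in>I. A i j * \<xi> j))"
    by (simp add: sum_distrib_left mult_ac)
  also have "\<dots> \<le> (\<Sum>i\<in>I. \<bar>cmod (\<eta> i)\<bar> * \<bar>cmod (\<Sum>j\<in>I. A i j * \<xi> j)\<bar>)"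
    by (rule order_trans[OF norm_sum]) (simp add: norm_mult)
  also have "\<dots> \<le> L2_set (\<lambda>i. cmod (\<eta> i)) I * L2_set (\<lambda>i. cmod (\<Sum>j\<in>I. A i j * \<xi> j)) I"
    by (rule L2_set_mult_ineq)
  also have "\<dots> \<le> 1 * L2_set (\<lambda>i. cmod (\<Sum>j\<in>I. A i j * \<xi> j)) I"
    using assms by (intro mult_right_mono) (simp_all add: L2_set_nonneg)
  finally show ?thesis
    unfolding mat_norm_def using assms(2) by (intro SUP_upper2[of \<xi>] ennreal_leI) auto
qed

lemma cblinfun_apply_sum: "cblinfun_apply f (\<Sum>k\<in>I. g k) = (\<Sum>k\<in>I. f (g k))"
proof (induction I rule: infinite_finite_induct)
  case empty
  show ?case using cblinfun_apply_scaleC[of f 0 0] by (simp add: complex_vector.scale_zero_left)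
qed (use cblinfun_apply_scaleC[of f 0 0] in \<open>simp_all add: cblinfun_apply_add complex_vector.scale_zero_left\<close>)

text \<open>
  A functional \<open>\<phi>\<close> applied entrywise to \<open>\<Sum> x\<^sub>k \<otimes> U\<^sub>k\<close> produces the matrix \<open>\<Sum> \<phi>(x\<^sub>k) U\<^sub>k\<close>. Its operator norm is
  controlled by the injective norm of the tensor \<open>t\<close> whose slices are the \<open>U\<^sub>k\<close>, since \<open>(\<phi>(x\<^sub>k))\<close> has \<open>\<ell>\<^sub>2\<close>
  norm at most \<open>p\<close>.
\<close>
lemma min_mnorms_tensor_le:
  fixes x :: "nat \<Rightarrow> 'a::complex_normed_vector"
  assumes t: "\<And>a b c. cmod (trilinear n t a b c) \<le> K * cl2 n a * cl2 n b * cl2 n c"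
    and x: "\<And>\<phi> :: 'a dual. norm \<phi> \<le> 1 \<Longrightarrow> cl2 d (\<lambda>k. cblinfun_apply \<phi> (x k)) \<le> p"
    and s: "\<And>k. cmod (s k) = 1 / (K * p)" and "K > 0" "p > 0" "d \<le> n"
  shows "min_mnorms n (\<lambda>i j. \<Sum>k<d. (s k * t k i j) *\<^sub>C x k) \<le> 1"
  unfolding min_mnorms_def fun_mnorms_def
proof (rule SUP_least, clarify)
  fix \<phi> :: "'a dual" assume \<phi>: "norm \<phi> \<le> 1"
  define a where "a k = (if k < d then s k * \<phi> (x k) else 0)" for k
  have "cl2 n a = L2_set (\<lambda>k. 1 / (K * p) * cmod (\<phi> (x k))) {..<d}"
    unfolding L2_set_def using \<open>d \<le> n\<close> s
    by (intro arg_cong[of _ _ sqrt] sum.mono_neutral_cong_right) (auto simp: a_def norm_mult)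
  also have "\<dots> = 1 / (K * p) * cl2 d (\<lambda>k. cblinfun_apply \<phi> (x k))"
    using \<open>K > 0\<close> \<open>p > 0\<close> by (subst L2_set_right_distrib) auto
  also have "\<dots> \<le> 1 / (K * p) * p" using x[OF \<phi>] \<open>K > 0\<close> \<open>p > 0\<close> by (intro mult_left_mono) auto
  finally have a: "K * cl2 n a \<le> 1" using \<open>K > 0\<close> \<open>p > 0\<close> by (simp add: field_simps)
  have entry: "\<phi> (\<Sum>k<d. (s k * t k i j) *\<^sub>C x k) = (\<Sum>k<n. t k i j * a k)" for i j
    unfolding cblinfun_apply_sum using \<open>d \<le> n\<close>
    by (intro sum.mono_neutral_cong_left) (auto simp: a_def cblinfun_apply_scaleC scaleC_complex_def)
  have "mat_norm {..<n} (\<lambda>i j. \<phi> (\<Sum>k<d. (s k * t k i j) *\<^sub>C x k)) \<le> ennreal 1"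
  proof (rule mat_norm_le)
    fix \<xi> \<eta>
    have "(\<Sum>i<n. \<Sum>j<n. \<phi> (\<Sum>k<d. (s k * t k i j) *\<^sub>C x k) * \<eta> i * \<xi> j)
      = (\<Sum>i<n. \<Sum>k<n. \<Sum>j<n. t k i j * a k * \<eta> i * \<xi> j)"
      unfolding entry sum_distrib_right by (intro sum.cong refl sum.swap)
    also have "\<dots> = trilinear n t a \<eta> \<xi>" unfolding trilinear_def by (rule sum.swap)
    finally have "cmod (\<Sum>i<n. \<Sum>j<n. \<phi> (\<Sum>k<d. (s k * t k i j) *\<^sub>C x k) * \<eta> i * \<xi> j) \<le> K * cl2 n a * (cl2 n \<eta> * cl2 n \<xi>)"
      using t[of a \<eta> \<xi>] by (simp add: mult.assoc)
    also have "\<dots> \<le> 1 * (cl2 n \<eta> * cl2 n \<xi>)"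
      using a by (intro mult_right_mono mult_nonneg_nonneg L2_set_nonneg) auto
    finally show "cmod (\<Sum>i<n. \<Sum>j<n. \<phi> (\<Sum>k<d. (s k * t k i j) *\<^sub>C x k) * \<eta> i * \<xi> j) \<le> 1 * cl2 n \<eta> * cl2 n \<xi>" by simp
  qed simp
  then show "mat_norm {..<n} (\<lambda>i j. \<phi> (\<Sum>k<d. (s k * t k i j) *\<^sub>C x k)) \<le> 1" by simp
qed

text \<open>
  The maximal norm of \<open>x\<close> is the completely bounded norm of the map from \<open>min(E\<^sup>*)\<close> to \<open>M\<^sub>n\<close> that it
  defines. Its amplification of size \<open>n\<close> at \<open>y\<close> is an operator on \<open>\<ell>\<^sub>2\<^sup>n \<otimes> \<ell>\<^sub>2\<^sup>n\<close>, and the left-hand side is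
  the matrix coefficient of this operator at the unit vector \<open>\<delta> = n\<^bsup>-1/2\<^esup> \<Sum> e\<^sub>i \<otimes> e\<^sub>i\<close>.
\<close>
lemma max_mnorms_ge_pairing:
  fixes x :: "nat \<Rightarrow> nat \<Rightarrow> 'a::complex_normed_vector" and y :: "nat \<Rightarrow> nat \<Rightarrow> 'a dual"
  assumes y: "min_mnorms n y \<le> 1" and n: "n > 0"
  shows "ennreal (cmod (\<Sum>i<n. \<Sum>j<n. y i j (x i j)) / n) \<le> max_mnorms n x"
proof -
  let ?I = "{..<n} \<times> {..<n}"
  define \<delta> :: "nat \<times> nat \<Rightarrow> complex" where "\<delta> = (\<lambda>(k, i). if k = i then of_real (1 / sqrt (real n)) else 0)"
  have "L2_set (\<lambda>i. cmod (\<delta> i)) ?I = sqrt (\<Sum>i<n. \<Sum>k<n. if i = k then 1 / real n else 0)"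
    unfolding L2_set_def \<delta>_def sum.cartesian_product'
    by (intro arg_cong[of _ _ sqrt] sum.cong) (auto simp: norm_divide power_divide)
  also have "\<dots> = 1" using n by simp
  finally have \<delta>: "L2_set (\<lambda>i. cmod (\<delta> i)) ?I \<le> 1" by simp
  have dd: "of_real (1 / sqrt (real n)) * of_real (1 / sqrt (real n)) = (of_real (1 / real n) :: complex)"
    using n by (simp flip: of_real_mult)
  have "(\<Sum>i\<in>?I. \<Sum>j\<in>?I. (case i of (k, i) \<Rightarrow> \<lambda>(l, j). y k l (x i j)) j * \<delta> i * \<delta> j)
    = (\<Sum>k<n. \<Sum>i<n. \<Sum>l<n. \<Sum>j<n. if k = i then if l = j then y k l (x i j) * of_real (1 / real n) else 0 else 0)"
    unfolding \<delta>_def sum.cartesian_product'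
    by (intro sum.cong refl) (auto simp: mult.assoc dd simp del: of_real_divide)
  also have "\<dots> = (\<Sum>k<n. \<Sum>i<n. if k = i then \<Sum>l<n. \<Sum>j<n. if l = j then y k l (x i j) * of_real (1 / real n) else 0 else 0)"
    by (intro sum.cong refl) auto
  also have "\<dots> = (\<Sum>k<n. \<Sum>l<n. y k l (x k l)) * of_real (1 / real n)"
    by (simp add: sum_distrib_right sum_divide_distrib)
  finally have "ennreal (cmod (\<Sum>i<n. \<Sum>j<n. y i j (x i j)) / n)
    = ennreal (cmod (\<Sum>i\<in>?I. \<Sum>j\<in>?I. (case i of (k, i) \<Rightarrow> \<lambda>(l, j). y k l (x i j)) j * \<delta> i * \<delta> j))"
    by (simp add: norm_mult norm_divide)
  also have "\<dots> \<le> mat_norm ?I (\<lambda>(k, i) (l, j). y k l (x i j))"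
    by (rule mat_norm_ge[OF \<delta> \<delta>])
  also have "\<dots> = mat_mnorms n n (\<lambda>k l i j. bidual_embed (x i j) (y k l))"
    by (simp add: mat_mnorms_def bidual_embed_apply)
  also have "\<dots> \<le> amp_norm n min_mnorms (mat_mnorms n) (\<lambda>f i j. bidual_embed (x i j) f)"
    unfolding amp_norm_def using y by (intro SUP_upper2[of y]) auto
  also have "\<dots> \<le> max_mnorms n x"
    unfolding max_mnorms_def dual_mnorms_def cb_norm_def by (rule SUP_upper) simp
  finally show ?thesis .
qed

lemma trilinear_cnj: "trilinear n (\<lambda>k i j. cnj (t k i j)) a b c
    = cnj (trilinear n t (\<lambda>k. cnj (a k)) (\<lambda>k. cnj (b k)) (\<lambda>k. cnj (c k)))"
  by (simp add: trilinear_def)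

text \<open>
  The test matrices are \<open>X = \<Sum> \<epsilon>\<^sub>k x\<^sub>k \<otimes> \<omega>\<^sub>k\<close> and \<open>Y = \<Sum> \<epsilon>\<^sub>k y\<^sub>k \<otimes> cnj \<omega>\<^sub>k\<close>, scaled to norm at most \<open>1\<close> in the minimal
  structures, where \<open>\<omega>\<^sub>k\<close> are the slices of a unimodular tensor of injective norm at most \<open>K = 50/7 \<surd>n\<close>.
  Entries of modulus one make the diagonal coefficients in the pairing of \<open>T X\<close> with \<open>Y\<close> exactly
  \<open>n\<^sup>2 y\<^sub>k(T x\<^sub>k)\<close>. The factors combine to \<open>n\<^sup>2 / (n K\<^sup>2 p q) = 1 / ((50/7)\<^sup>2 p q)\<close>, so the size of the matrices cancels.
\<close>
lemma pairing_le_amp_norm: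
  fixes T :: "'e::complex_normed_vector \<Rightarrow>\<^sub>C\<^sub>L 'f::complex_normed_vector"
    and x :: "nat \<Rightarrow> 'e" and y :: "nat \<Rightarrow> 'f dual"
  assumes d: "d \<le> n" and p: "p > 0" and q: "q > 0"
    and x: "\<And>\<phi> :: 'e dual. norm \<phi> \<le> 1 \<Longrightarrow> cl2 d (\<lambda>k. cblinfun_apply \<phi> (x k)) \<le> p"
    and y: "\<And>\<Phi> :: 'f dual dual. norm \<Phi> \<le> 1 \<Longrightarrow> cl2 d (\<lambda>k. cblinfun_apply \<Phi> (y k)) \<le> q"
  shows "ennreal (cmod (\<Sum>k<d. y k (T (x k)))) \<le> ennreal ((50 / 7)\<^sup>2 * (p * q)) * amp_norm n min_mnorms max_mnorms T"
proof (cases "n = 0")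
  case True
  then show ?thesis using d by simp
next
  case False
  then have n: "n > 0" by simp
  obtain \<omega> where \<omega>: "\<And>k i j. \<omega> k i j \<in> phases"
    "\<And>a b c. cmod (trilinear n \<omega> a b c) \<le> 50 / 7 * sqrt n * cl2 n a * cl2 n b * cl2 n c"
    using exists_phase_tensor[of n] by blast
  define K where "K = 50 / 7 * sqrt n"
  have K: "K > 0" using n by (simp add: K_def)
  have \<omega>cnj: "cmod (trilinear n (\<lambda>k i j. cnj (\<omega> k i j)) a b c) \<le> K * cl2 n a * cl2 n b * cl2 n c" for a b c
    using \<omega>(2)[of "\<lambda>k. cnj (a k)" "\<lambda>k. cnj (b k)" "\<lambda>k. cnj (c k)"] by (simp add: trilinear_cnj K_def)
  define c where "c r s = (\<Sum>i<n. \<Sum>j<n. cnj (\<omega> r i j) * \<omega> s i j) * y r (T (x s))" for r s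
  obtain \<epsilon> :: "nat \<Rightarrow> complex" where \<epsilon>: "range \<epsilon> \<subseteq> {1, -1}"
    "cmod (\<Sum>r<d. c r r) \<le> cmod (\<Sum>r<d. \<Sum>s<d. \<epsilon> r * \<epsilon> s * c r s)"
    using exists_signs_diagonal_le[where ?c0.0 = 0 and d = d and c = c] by auto
  have \<epsilon>1: "cmod (\<epsilon> k) = 1" for k using \<epsilon>(1) by (auto simp: subset_iff dest!: spec[of _ "\<epsilon> k"])
  define X where "X i j = (\<Sum>k<d. (of_real (1 / (K * p)) * \<epsilon> k * \<omega> k i j) *\<^sub>C x k)" for i j
  define Y where "Y i j = (\<Sum>k<d. (of_real (1 / (K * q)) * \<epsilon> k * cnj (\<omega> k i j)) *\<^sub>C y k)" for i j
  have X: "min_mnorms n X \<le> 1"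
    unfolding X_def by (rule min_mnorms_tensor_le[OF \<omega>(2)[folded K_def] x _ K p d]) (use K p \<epsilon>1 in \<open>simp_all add: norm_mult norm_divide\<close>)
  have Y: "min_mnorms n Y \<le> 1"
    unfolding Y_def by (rule min_mnorms_tensor_le[OF \<omega>cnj y _ K q d]) (use K q \<epsilon>1 in \<open>simp_all add: norm_mult norm_divide\<close>)
  have unit: "cnj (\<omega> r i j) * \<omega> r i j = 1" for r i j using \<omega>(1)[of r i j] by auto
  have sum_apply: "cblinfun_apply (\<Sum>k\<in>A. f k) u = (\<Sum>k\<in>A. f k u)" for A and f :: "nat \<Rightarrow> 'f dual" and u
    using cblinfun_apply_sum[of "bidual_embed u" f A] by (simp add: bidual_embed_apply)
  have "(\<Sum>i<n. \<Sum>j<n. Y i j (T (X i j)))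
    = (\<Sum>i<n. \<Sum>j<n. \<Sum>s<d. \<Sum>r<d. of_real (1 / (K\<^sup>2 * (p * q))) * (\<epsilon> r * \<epsilon> s * (cnj (\<omega> r i j) * \<omega> s i j * y r (T (x s)))))"
    unfolding X_def Y_def sum_apply cblinfun_apply_sum
    by (intro sum.cong refl)
      (simp add: cblinfun_apply_scaleC scaleC_cblinfun_apply scaleC_complex_def power2_eq_square mult_ac)
  also have "\<dots> = (\<Sum>i<n. \<Sum>j<n. \<Sum>r<d. \<Sum>s<d. of_real (1 / (K\<^sup>2 * (p * q))) * (\<epsilon> r * \<epsilon> s * (cnj (\<omega> r i j) * \<omega> s i j * y r (T (x s)))))"
    by (intro sum.cong refl sum.swap)
  also have "\<dots> = of_real (1 / (K\<^sup>2 * (p * q))) * (\<Sum>i<n. \<Sum>j<n. \<Sum>r<d. \<Sum>s<d. \<epsilon> r * \<epsilon> s * (cnj (\<omega> r i j) * \<omega> s i j * y r (T (x s))))"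
    by (simp only: sum_distrib_left)
  also have "(\<Sum>i<n. \<Sum>j<n. \<Sum>r<d. \<Sum>s<d. \<epsilon> r * \<epsilon> s * (cnj (\<omega> r i j) * \<omega> s i j * y r (T (x s))))
    = (\<Sum>r<d. \<Sum>s<d. \<epsilon> r * \<epsilon> s * c r s)"
  proof -
    have "(\<Sum>i<n. \<Sum>j<n. \<Sum>r<d. \<Sum>s<d. f i j r s) = (\<Sum>r<d. \<Sum>s<d. \<Sum>i<n. \<Sum>j<n. f i j r s)"
      for f :: "nat \<Rightarrow> nat \<Rightarrow> nat \<Rightarrow> nat \<Rightarrow> complex"
    proof -
      have "(\<Sum>i<n. \<Sum>j<n. \<Sum>r<d. \<Sum>s<d. f i j r s) = (\<Sum>a\<in>{..<n}\<times>{..<n}. \<Sum>b\<in>{..<d}\<times>{..<d}. f (fst a) (snd a) (fst b) (snd b))"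
        by (simp add: sum.cartesian_product')
      also have "\<dots> = (\<Sum>b\<in>{..<d}\<times>{..<d}. \<Sum>a\<in>{..<n}\<times>{..<n}. f (fst a) (snd a) (fst b) (snd b))" by (rule sum.swap)
      finally show ?thesis by (simp add: sum.cartesian_product')
    qed
    then show ?thesis by (simp add: c_def sum_distrib_left sum_distrib_right)
  qed
  finally have sumXY: "cmod (\<Sum>i<n. \<Sum>j<n. Y i j (T (X i j))) = 1 / (K\<^sup>2 * (p * q)) * cmod (\<Sum>r<d. \<Sum>s<d. \<epsilon> r * \<epsilon> s * c r s)"
    using K p q by (simp add: norm_mult norm_divide norm_power)
  have "(\<Sum>r<d. c r r) = of_nat (n * n) * (\<Sum>k<d. y k (T (x k)))"
    by (simp add: c_def unit sum_distrib_left)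
  then have "real n * real n * cmod (\<Sum>k<d. y k (T (x k))) \<le> cmod (\<Sum>r<d. \<Sum>s<d. \<epsilon> r * \<epsilon> s * c r s)"
    using \<epsilon>(2) by (simp add: norm_mult)
  then have "1 / (K\<^sup>2 * (p * q)) * (real n * real n * cmod (\<Sum>k<d. y k (T (x k)))) / n \<le> cmod (\<Sum>i<n. \<Sum>j<n. Y i j (T (X i j))) / n"
    unfolding sumXY using K p q by (intro divide_right_mono mult_left_mono) auto
  moreover have "1 / (K\<^sup>2 * (p * q)) * (real n * real n * D) / n = D / ((50 / 7)\<^sup>2 * (p * q))" for D
    using n p q by (simp add: K_def power_mult_distrib field_simps)
  ultimately have "ennreal (cmod (\<Sum>k<d. y k (T (x k))) / ((50 / 7)\<^sup>2 * (p * q))) \<le> ennreal (cmod (\<Sum>i<n. \<Sum>j<n. Y i j (T (X i j))) / n)"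
    by (intro ennreal_leI) simp
  also have "\<dots> \<le> max_mnorms n (\<lambda>i j. T (X i j))" by (rule max_mnorms_ge_pairing[OF Y n])
  also have "\<dots> \<le> amp_norm n min_mnorms max_mnorms T"
    unfolding amp_norm_def using X by (intro SUP_upper2[of X]) auto
  finally have "ennreal ((50 / 7)\<^sup>2 * (p * q)) * ennreal (cmod (\<Sum>k<d. y k (T (x k))) / ((50 / 7)\<^sup>2 * (p * q)))
    \<le> ennreal ((50 / 7)\<^sup>2 * (p * q)) * amp_norm n min_mnorms max_mnorms T"
    by (intro mult_left_mono) auto
  then show ?thesis using p q by (simp flip: ennreal_mult)
qed

section \<open>Bounded operators on finite-dimensional spaces\<close>

text \<open>
  Coordinate vectors with respect to a finite family are encoded as functions vanishing off the
  family. With this encoding bounded closed sets of coordinates are compact by Tychonoff's theorem.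
\<close>
lemma compact_finite_support_box:
  "compact {f :: 'i \<Rightarrow> complex. (\<forall>i. if i \<in> I then cmod (f i) \<le> R else f i = 0)}" (is "compact ?A")
proof -
  have "?A = PiE UNIV (\<lambda>i. if i \<in> I then cball 0 R else {0})"
    by (auto simp: PiE_UNIV_domain Pi_def)
  moreover have "compactin (product_topology (\<lambda>_. euclidean) UNIV) (PiE UNIV (\<lambda>i :: 'i. if i \<in> I then cball (0 :: complex) R else {0}))"
    by (subst compactin_PiE) auto
  ultimately show ?thesis by (simp add: euclidean_product_topology)
qed

lemma exists_cblinfun:
  fixes f :: "'a::complex_normed_vector \<Rightarrow> 'b::complex_normed_vector"
  assumes "\<And>x y. f (x + y) = f x + f y" "\<And>c x. f (c *\<^sub>C x) = c *\<^sub>C f x" "\<And>x. norm (f x) \<le> K * norm x"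
  obtains F where "\<And>x. cblinfun_apply F x = f x"
proof -
  have bl: "bounded_linear f"
    by (rule bounded_linear_intro[where K = K]) (simp_all add: assms scaleR_scaleC mult.commute)
  have "cblinfun_apply (Abs_cblinfun (Blinfun f)) x = f x" for x
    by (simp add: cblinfun_apply.rep_eq Abs_cblinfun_inverse bounded_linear_Blinfun_apply[OF bl] assms(2))
  then show ?thesis by (rule that)
qed

lemma norm_cblinfun_le:
  assumes "\<And>x. norm (cblinfun_apply F x) \<le> K * norm x" "K \<ge> 0"
  shows "norm F \<le> K"
  using assms by transfer (rule norm_blinfun_bound)

text \<open>
  The hypothesis says that \<open>\<Sum> a\<^sub>k y\<^sub>k\<close> has norm at most \<open>Q |a|\<close> in the dual. In this form it passes
  to every functional on the dual, not only to evaluations at points.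
\<close>
lemma cl2_bidual_le:
  fixes y :: "nat \<Rightarrow> 'f::complex_normed_vector dual" and \<Phi> :: "'f dual dual"
  assumes y: "\<And>x. cl2 d (\<lambda>k. cblinfun_apply (y k) x) \<le> Q * norm x" and "Q \<ge> 0" and \<Phi>: "norm \<Phi> \<le> 1"
  shows "cl2 d (\<lambda>k. cblinfun_apply \<Phi> (y k)) \<le> Q"
proof (rule cl2_le_if_pairing_le)
  fix a
  define f where "f = (\<Sum>k<d. a k *\<^sub>C y k)"
  have "norm f \<le> Q * cl2 d a"
  proof (rule norm_cblinfun_le)
    fix x
    have "f x = (\<Sum>k<d. a k * y k x)"
      using cblinfun_apply_sum[of "bidual_embed x" "\<lambda>k. a k *\<^sub>C y k" "{..<d}"]
      by (simp add: f_def bidual_embed_apply scaleC_cblinfun_apply scaleC_complex_def)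
    also have "cmod \<dots> \<le> (\<Sum>k<d. \<bar>cmod (a k)\<bar> * \<bar>cmod (y k x)\<bar>)"
      by (rule order_trans[OF norm_sum]) (simp add: norm_mult)
    also have "\<dots> \<le> cl2 d a * cl2 d (\<lambda>k. cblinfun_apply (y k) x)" by (rule L2_set_mult_ineq)
    also have "\<dots> \<le> cl2 d a * (Q * norm x)" using y by (intro mult_left_mono L2_set_nonneg)
    finally show "norm (f x) \<le> Q * cl2 d a * norm x" by (simp add: mult_ac)
  qed (use \<open>Q \<ge> 0\<close> in \<open>simp add: L2_set_nonneg\<close>)
  have "(\<Sum>k<d. a k * \<Phi> (y k)) = \<Phi> f"
    by (simp add: f_def cblinfun_apply_sum cblinfun_apply_scaleC scaleC_complex_def)
  also have "cmod \<dots> \<le> norm \<Phi> * norm f" by (rule norm_cblinfun)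
  also have "\<dots> \<le> 1 * (Q * cl2 d a)"
    using \<Phi> \<open>norm f \<le> _\<close> by (intro mult_mono) auto
  finally show "cmod (\<Sum>k<d. a k * \<Phi> (y k)) \<le> Q * cl2 d a" by simp
qed fact

text \<open>
  By linear independence the norm of \<open>\<Sum> f\<^sub>b b\<close> has a positive minimum \<open>m\<close> on the compact set \<open>\<Sum> |f\<^sub>b| = 1\<close>.
\<close>
lemma coordinates_bounded:
  fixes B :: "'a::complex_normed_vector set"
  assumes B: "finite B" "\<not> cdependent B"
  obtains K where "K \<ge> 0" "\<And>c b. b \<in> B \<Longrightarrow> cmod (c b) \<le> K * norm (\<Sum>b\<in>B. c b *\<^sub>C b)"
proof -
  define S where "S = {f. (\<forall>b. if b \<in> B then cmod (f b) \<le> 1 else f b = 0)} \<inter> {f. (\<Sum>b\<in>B. cmod (f b)) = 1}"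
  have coord: "continuous_on UNIV (\<lambda>f :: 'a \<Rightarrow> complex. f b)" for b by simp
  have "closed {f. (\<Sum>b\<in>B. cmod (f b)) = 1}"
    by (intro closed_Collect_eq continuous_intros coord)
  then have S: "compact S"
    unfolding S_def by (intro compact_Int_closed compact_finite_support_box)
  have scale: "bounded_linear (\<lambda>z. z *\<^sub>C b)" for b :: 'a
    by (rule bounded_linear_intro[where K = "norm b"])
      (simp_all add: scaleC_add_left scaleR_scaleC scaleC_scaleC norm_scaleC scaleC_complex_def)
  have "continuous_on UNIV (\<lambda>f :: 'a \<Rightarrow> complex. norm (\<Sum>b\<in>B. f b *\<^sub>C b))"
    by (intro continuous_intros bounded_linear.continuous_on[OF scale] coord)
  then have cont: "continuous_on S (\<lambda>f. norm (\<Sum>b\<in>B. f b *\<^sub>C b))"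
    by (rule continuous_on_subset) simp
  show ?thesis
  proof (cases "S = {}")
    case True
    have "B = {}"
    proof (rule ccontr)
      assume "B \<noteq> {}"
      then obtain b where "b \<in> B" by blast
      then have "(\<lambda>x. if x = b then 1 else 0) \<in> S" using B(1) by (auto simp: S_def if_distrib cong: if_cong)
      with True show False by blast
    qed
    then show ?thesis by (intro that[of 0]) auto
  next
    case False
    obtain f where f: "f \<in> S" "\<And>g. g \<in> S \<Longrightarrow> norm (\<Sum>b\<in>B. f b *\<^sub>C b) \<le> norm (\<Sum>b\<in>B. g b *\<^sub>C b)"
      using continuous_attains_inf[OF S False cont] by blast
    define m where "m = norm (\<Sum>b\<in>B. f b *\<^sub>C b)"
    have "m \<noteq> 0"
    proof
      assume "m = 0"
      then have "\<forall>b\<in>B. f b = 0"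
        using B complex_vector.independentD[OF B(2,1) subset_refl, of f] by (auto simp: m_def)
      then show False using f(1) by (simp add: S_def)
    qed
    then have m: "m > 0" by (simp add: m_def)
    show ?thesis
    proof (rule that[of "1 / m"])
      fix c b assume b: "b \<in> B"
      define r where "r = (\<Sum>b\<in>B. cmod (c b))"
      have cr: "cmod (c b) \<le> r" if "b \<in> B" for b
        unfolding r_def using B(1) that by (intro member_le_sum) auto
      show "cmod (c b) \<le> 1 / m * norm (\<Sum>b\<in>B. c b *\<^sub>C b)"
      proof (cases "r = 0")
        case True
        then show ?thesis using cr[OF b] m by simp
      next
        case False
        then have r: "r > 0" using cr[OF b] order_trans[OF norm_ge_zero] by fastforce
        define g where "g x = (if x \<in> B then of_real (1 / r) * c x else 0)" for x
        have ng: "cmod (g b) = cmod (c b) / r" if "b \<in> B" for b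
          using that r by (simp add: g_def norm_mult norm_divide)
        have "(\<Sum>b\<in>B. cmod (g b)) = r / r"
          by (simp add: ng sum_divide_distrib[symmetric] cong: sum.cong) (simp add: r_def)
        moreover have "if b \<in> B then cmod (g b) \<le> 1 else g b = 0" for b
          using cr[of b] r ng[of b] by (simp add: g_def)
        ultimately have "g \<in> S" using r by (simp add: S_def)
        from f(2)[OF this] have "m \<le> norm (\<Sum>b\<in>B. of_real (1 / r) *\<^sub>C c b *\<^sub>C b)"
          by (simp add: m_def g_def scaleC_scaleC cong: sum.cong)
        also have "\<dots> = norm (of_real (1 / r) *\<^sub>C (\<Sum>b\<in>B. c b *\<^sub>C b))"
          by (simp only: complex_vector.scale_sum_right)
        also have "\<dots> = 1 / r * norm (\<Sum>b\<in>B. c b *\<^sub>C b)"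
          using r by (simp add: norm_scaleC norm_divide)
        finally have "m * r \<le> norm (\<Sum>b\<in>B. c b *\<^sub>C b)" using r by (simp add: field_simps)
        moreover have "m * cmod (c b) \<le> m * r" using cr[OF b] m by simp
        ultimately have "m * cmod (c b) \<le> norm (\<Sum>b\<in>B. c b *\<^sub>C b)" by linarith
        then show ?thesis using m by (simp add: field_simps)
      qed
    qed (use m in simp)
  qed
qed

section \<open>The trace of an operator that factors through a Hilbert space\<close>

text \<open>
  An operator \<open>v\<close> into a Hilbert space pulls the inner product back to a positive semidefinite form on
  its domain. Working with this form instead of \<open>H\<close> keeps all vectors in the domain of \<open>v\<close>; the price is that
  nonzero vectors may be null.
\<close>
locale hilbert_operator = hilbert_space H for H :: "'h hspace" +
  fixes v :: "'f::complex_normed_vector \<Rightarrow> 'h"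
  assumes v: "bounded_into H v"
begin

definition form :: "'f \<Rightarrow> 'f \<Rightarrow> complex" where "form x y = hinner H (v x) (v y)"

definition seminorm :: "'f \<Rightarrow> real" where "seminorm x = hnorm H (v x)"

lemma v_closed: "v x \<in> hcarrier H" using v by (auto simp: bounded_into_def)

lemma form_add_left: "form (x + y) z = form x z + form y z"
  using v by (simp add: form_def bounded_into_def inner_add_left v_closed)

lemma form_scale_left: "form (c *\<^sub>C x) z = c * form x z"
  using v by (simp add: form_def bounded_into_def inner_scale_left v_closed)

lemma form_cnj: "form x y = cnj (form y x)"
  unfolding form_def by (rule inner_commute[OF v_closed v_closed])

lemma form_add_right: "form z (x + y) = form z x + form z y"
  using form_cnj[of z "x + y"] form_cnj[of z x] form_cnj[of z y] by (simp add: form_add_left)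

lemma form_scale_right: "form z (c *\<^sub>C x) = cnj c * form z x"
  using form_cnj[of z "c *\<^sub>C x"] form_cnj[of z x] by (simp add: form_scale_left)

lemma form_zero_left: "form 0 z = 0"
  using form_scale_left[of 0 0 z] by (simp add: complex_vector.scale_zero_left)

lemma form_zero_right: "form z 0 = 0"
  using form_cnj[of z 0] by (simp add: form_zero_left)

lemma form_sum_left: "form (\<Sum>i\<in>I. f i) z = (\<Sum>i\<in>I. form (f i) z)"
  by (induction I rule: infinite_finite_induct) (simp_all add: form_zero_left form_add_left)

lemma form_sum_right: "form z (\<Sum>i\<in>I. f i) = (\<Sum>i\<in>I. form z (f i))"
  by (induction I rule: infinite_finite_induct) (simp_all add: form_zero_right form_add_right)

lemma form_diff_left: "form (x - y) z = form x z - form y z"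
  using form_add_left[of "x - y" y z] by simp

lemma form_self: "form x x = of_real ((seminorm x)\<^sup>2)"
  unfolding form_def seminorm_def hnorm_def
  by (subst inner_self_real[OF v_closed]) (simp add: inner_self_nonneg[OF v_closed])

lemma seminorm_nonneg: "seminorm x \<ge> 0"
  using inner_self_nonneg[OF v_closed, of x] by (simp add: seminorm_def hnorm_def)

lemma form_le: "cmod (form x y) \<le> seminorm x * seminorm y"
  unfolding form_def seminorm_def by (rule cauchy_schwarz[OF v_closed v_closed])

lemma form_null_left: "seminorm x = 0 \<Longrightarrow> form x y = 0"
  using form_le[of x y] by simp

definition orthonormal :: "nat \<Rightarrow> (nat \<Rightarrow> 'f) \<Rightarrow> bool" where
  "orthonormal d z \<longleftrightarrow> (\<forall>i<d. \<forall>j<d. form (z i) (z j) = (if i = j then 1 else 0))"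

lemma form_combination:
  assumes "orthonormal d z" "k < d"
  shows "form (\<Sum>i<d. a i *\<^sub>C z i) (z k) = a k"
proof -
  have "form (\<Sum>i<d. a i *\<^sub>C z i) (z k) = (\<Sum>i<d. a i * form (z i) (z k))"
    by (simp only: form_sum_left form_scale_left)
  also have "\<dots> = (\<Sum>i<d. if i = k then a i else 0)"
    using assms by (intro sum.cong refl) (simp add: orthonormal_def)
  finally have "form (\<Sum>i<d. a i *\<^sub>C z i) (z k) = (\<Sum>i<d. if i = k then a i else 0)" .
  then show ?thesis using assms(2) by simp
qed

lemma seminorm_combination:
  assumes "orthonormal d z"
  shows "seminorm (\<Sum>i<d. a i *\<^sub>C z i) = cl2 d a"
proof -
  have "complex_of_real ((seminorm (\<Sum>i<d. a i *\<^sub>C z i))\<^sup>2) = (\<Sum>k<d. cnj (a k) * a k)"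
    unfolding form_self[symmetric] form_sum_right[of _ "\<lambda>i. a i *\<^sub>C z i"] form_scale_right
    using form_combination[OF assms] by simp
  also have "\<dots> = complex_of_real ((cl2 d a)\<^sup>2)"
    unfolding cl2_square by (simp add: complex_norm_square mult.commute del: of_real_power)
  finally have "(seminorm (\<Sum>i<d. a i *\<^sub>C z i))\<^sup>2 = (cl2 d a)\<^sup>2" by (simp only: of_real_eq_iff)
  then show ?thesis by (simp add: seminorm_nonneg L2_set_nonneg)
qed

lemma bessel:
  assumes "orthonormal d z"
  shows "cl2 d (\<lambda>k. form x (z k)) \<le> seminorm x"
proof (rule cl2_le_if_pairing_le[OF _ seminorm_nonneg])
  fix a
  have "(\<Sum>k<d. a k * form x (z k)) = form x (\<Sum>k<d. cnj (a k) *\<^sub>C z k)"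
    by (simp add: form_sum_right form_scale_right)
  also have "cmod \<dots> \<le> seminorm x * cl2 d (\<lambda>k. cnj (a k))"
    unfolding seminorm_combination[OF assms, symmetric] by (rule form_le)
  finally show "cmod (\<Sum>k<d. a k * form x (z k)) \<le> seminorm x * cl2 d a" by simp
qed

text \<open>
  Gram-Schmidt for a form that may be degenerate: a vector enlarges the system only if its component
  orthogonal to the earlier ones is not null, and the expansion of a vector holds up to a null vector.
\<close>
lemma orthonormal_system:
  assumes "finite B"
  shows "\<exists>d z. d \<le> card B \<and> orthonormal d z
    \<and> (\<forall>b\<in>B. seminorm (b - (\<Sum>k<d. form b (z k) *\<^sub>C z k)) = 0)"
  using assms
proof (induction B)
  case empty
  show ?case by (intro exI[of _ 0]) (simp add: orthonormal_def)
next
  case (insert b B)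
  then obtain d z where IH: "d \<le> card B" "orthonormal d z"
    "\<And>x. x \<in> B \<Longrightarrow> seminorm (x - (\<Sum>k<d. form x (z k) *\<^sub>C z k)) = 0" by blast
  define w where "w = b - (\<Sum>k<d. form b (z k) *\<^sub>C z k)"
  show ?case
  proof (cases "seminorm w = 0")
    case True
    with IH insert.hyps show ?thesis
      by (intro exI[of _ d] exI[of _ z]) (auto simp: w_def)
  next
    case False
    define r where "r = seminorm w"
    have r: "r > 0" using False seminorm_nonneg[of w] by (simp add: r_def)
    define z' where "z' = fun_upd z d (of_real (1 / r) *\<^sub>C w)"
    have z': "z' d = of_real (1 / r) *\<^sub>C w" "\<And>k. k < d \<Longrightarrow> z' k = z k" by (auto simp: z'_def)
    have wz: "form w (z k) = 0" if "k < d" for k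
      unfolding w_def form_diff_left form_combination[OF IH(2) that] by simp
    have zw: "form (z k) w = 0" if "k < d" for k
      using form_cnj[of "z k" w] wz[OF that] by simp
    have on: "orthonormal (Suc d) z'"
    proof -
      have "form (z' d) (z' d) = 1"
        unfolding z'(1) form_scale_left form_scale_right
        unfolding form_self r_def[symmetric]
        using r by (simp add: power2_eq_square)
      then show ?thesis
        using IH(2) by (auto simp: orthonormal_def less_Suc_eq z' form_scale_left form_scale_right wz zw)
    qed
    have comb: "(\<Sum>k<Suc d. form x (z' k) *\<^sub>C z' k) = (\<Sum>k<d. form x (z k) *\<^sub>C z k) + form x (z' d) *\<^sub>C z' d" for x
      by (simp add: z'(2))
    have "seminorm (x - (\<Sum>k<Suc d. form x (z' k) *\<^sub>C z' k)) = 0" if "x \<in> insert b B" for x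
    proof (cases "x = b")
      case True
      have "form b w = form w w"
      proof -
        have "form (\<Sum>k<d. form b (z k) *\<^sub>C z k) w = 0"
          by (simp add: form_sum_left form_scale_left zw)
        then show ?thesis by (simp add: w_def form_diff_left)
      qed
      then have "form b (z' d) *\<^sub>C z' d = w"
        using r by (simp add: z' form_scale_right form_self r_def[symmetric] scaleC_scaleC power2_eq_square scaleC_one)
      then have "b - (\<Sum>k<Suc d. form b (z' k) *\<^sub>C z' k) = 0"
        unfolding comb by (simp add: w_def)
      then show ?thesis using True form_self[of 0] by (simp add: form_zero_left)
    next
      case False
      define u where "u = x - (\<Sum>k<d. form x (z k) *\<^sub>C z k)"
      have u: "seminorm u = 0" using IH(3) that False by (simp add: u_def)
      have "form x w = form u w"
        by (simp add: u_def form_diff_left form_sum_left form_scale_left zw)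
      also have "\<dots> = 0" by (rule form_null_left[OF u])
      finally have "form x (z' d) = 0" by (simp add: z' form_scale_right)
      then show ?thesis unfolding comb using u by (simp add: u_def complex_vector.scale_zero_left)
    qed
    with on IH(1) insert.hyps show ?thesis by (intro exI[of _ "Suc d"] exI[of _ z']) auto
  qed
qed

text \<open>
  With respect to a basis \<open>B\<close> of the range, \<open>T = \<Sum> g\<^sub>b \<otimes> b\<close> and \<open>tr(S T) = \<Sum> g\<^sub>b(S b)\<close>. Expand every \<open>b\<close> in an
  orthonormal system for the form. The null vector left over does not contribute, because
  the hypothesis on \<open>S\<close> makes \<open>g\<^sub>b \<circ> S\<close> vanish on null vectors; for this the coordinate
  functionals \<open>g\<^sub>b\<close> have to be bounded.
\<close>
lemma ctrace_eq_sum_form: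
  fixes T :: "'e::complex_normed_vector \<Rightarrow>\<^sub>C\<^sub>L 'f" and S :: "'f \<Rightarrow>\<^sub>C\<^sub>L 'e"
  assumes T: "rank_at_most T n"
    and S: "\<And>(\<phi> :: 'e dual) x. cmod (cblinfun_apply \<phi> (S x)) \<le> P * norm \<phi> * seminorm x"
  shows "\<exists>d\<le>n. \<exists>z. orthonormal d z \<and> ctrace (S o\<^sub>C\<^sub>L T) = (\<Sum>k<d. form (T (S (z k))) (z k))"
proof -
  obtain B0 where B0: "finite B0" "card B0 \<le> n" "range T \<subseteq> cspan B0"
    using T by (auto simp: rank_at_most_def)
  obtain B where B: "B \<subseteq> B0" "\<not> cdependent B" "B0 \<subseteq> cspan B"
    using complex_vector.maximal_independent_subset[of B0] by blast
  have fB: "finite B" using B(1) B0(1) by (rule finite_subset)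
  have cB: "card B \<le> n" using card_mono[OF B0(1) B(1)] B0(2) by simp
  have TB: "T x \<in> cspan B" for x
    using B0(3) complex_vector.span_minimal[OF B(3) complex_vector.subspace_span] by blast
  define c where "c b x = crepresentation B (T x) b" for b x
  have Tc: "T x = (\<Sum>b\<in>B. c b x *\<^sub>C b)" for x
    unfolding c_def by (rule complex_vector.sum_representation_eq[OF B(2) TB fB subset_refl, symmetric])
  obtain K where K: "K \<ge> 0" "\<And>c b. b \<in> B \<Longrightarrow> cmod (c b) \<le> K * norm (\<Sum>b\<in>B. c b *\<^sub>C b)"
    using coordinates_bounded[OF fB B(2)] by metis
  have "\<exists>g :: 'e dual. \<forall>x. g x = c b x" if b: "b \<in> B" for b
  proof -
    have "c b (x + y) = c b x + c b y" "c b (s *\<^sub>C x) = s *\<^sub>C c b x" for x y s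
      using TB by (simp_all add: c_def cblinfun_apply_add cblinfun_apply_scaleC complex_vector.representation_add[OF B(2)]
          complex_vector.representation_scale[OF B(2)] scaleC_complex_def)
    moreover have "cmod (c b x) \<le> (K * norm T) * norm x" for x
    proof -
      have "cmod (c b x) \<le> K * norm (T x)" using K(2)[OF b, of "\<lambda>b. c b x"] by (simp add: Tc[symmetric])
      also have "\<dots> \<le> K * (norm T * norm x)" using K(1) by (intro mult_left_mono norm_cblinfun)
      finally show ?thesis by (simp add: mult.assoc)
    qed
    ultimately show ?thesis by (metis exists_cblinfun)
  qed
  then obtain g :: "'f \<Rightarrow> 'e dual" where g: "\<And>b x. b \<in> B \<Longrightarrow> g b x = c b x" by metis
  obtain d z where z: "d \<le> card B" "orthonormal d z"
    "\<And>b. b \<in> B \<Longrightarrow> seminorm (b - (\<Sum>k<d. form b (z k) *\<^sub>C z k)) = 0"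
    using orthonormal_system[OF fB] by blast
  have gS: "g b (S b) = (\<Sum>k<d. form b (z k) * g b (S (z k)))" if b: "b \<in> B" for b
  proof -
    define u where "u = b - (\<Sum>k<d. form b (z k) *\<^sub>C z k)"
    have "g b (S u) = 0" using S[of "g b" u] z(3)[OF b] by (simp add: u_def)
    moreover have "b = u + (\<Sum>k<d. form b (z k) *\<^sub>C z k)" by (simp add: u_def)
    then have "g b (S b) = g b (S u) + g b (S (\<Sum>k<d. form b (z k) *\<^sub>C z k))"
      by (metis cblinfun_apply_add)
    ultimately show ?thesis
      by (simp add: cblinfun_apply_sum cblinfun_apply_scaleC scaleC_complex_def)
  qed
  have "ctrace (S o\<^sub>C\<^sub>L T) = (\<Sum>b\<in>B. g b (S b))"
    by (rule ctrace_eq_sum[OF fB])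
      (simp add: cblinfun_compose_apply Tc cblinfun_apply_sum cblinfun_apply_scaleC g cong: sum.cong)
  also have "\<dots> = (\<Sum>k<d. \<Sum>b\<in>B. form b (z k) * g b (S (z k)))"
    by (simp add: gS cong: sum.cong) (rule sum.swap)
  also have "\<dots> = (\<Sum>k<d. form (T (S (z k))) (z k))"
    by (simp add: Tc form_sum_left form_scale_left g mult.commute cong: sum.cong)
  finally show ?thesis using z(1,2) cB by (intro exI[of _ d]) auto
qed

text \<open>
  The trace formula has the shape of \<open>pairing_le_amp_norm\<close> with \<open>x\<^sub>k = S z\<^sub>k\<close> and \<open>y\<^sub>k = \<langle>v \<cdot>, v z\<^sub>k\<rangle>\<close>. Orthonormality
  bounds the weak \<open>\<ell>\<^sub>2\<close> norms: by \<open>P\<close> through \<open>\<parallel>\<Sum> a\<^sub>k v z\<^sub>k\<parallel> = |a|\<close>, and by \<open>Q\<close> through Bessel's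
  inequality.
\<close>
lemma ctrace_le_amp_norm:
  fixes T :: "'e::complex_normed_vector \<Rightarrow>\<^sub>C\<^sub>L 'f" and S :: "'f \<Rightarrow>\<^sub>C\<^sub>L 'e"
  assumes T: "rank_at_most T n" and P: "P > 0" and Q: "Q > 0"
    and S: "\<And>(\<phi> :: 'e dual) x. cmod (cblinfun_apply \<phi> (S x)) \<le> P * norm \<phi> * seminorm x"
    and vQ: "\<And>x. seminorm x \<le> Q * norm x"
  shows "ennreal (cmod (ctrace (S o\<^sub>C\<^sub>L T))) \<le> ennreal ((50 / 7)\<^sup>2 * (P * Q)) * amp_norm n min_mnorms max_mnorms T"
proof -
  obtain d z where z: "d \<le> n" "orthonormal d z"
    "ctrace (S o\<^sub>C\<^sub>L T) = (\<Sum>k<d. form (T (S (z k))) (z k))"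
    using ctrace_eq_sum_form[OF T S] by blast
  have "\<exists>y :: 'f dual. \<forall>x. y x = form x u" for u
  proof -
    have "cmod (form x u) \<le> (Q * seminorm u) * norm x" for x
      using form_le[of x u] mult_right_mono[OF vQ[of x] seminorm_nonneg[of u]] by (simp add: mult_ac)
    then show ?thesis
      by (metis exists_cblinfun[of "\<lambda>x. form x u"] form_add_left form_scale_left scaleC_complex_def)
  qed
  then obtain y :: "'f \<Rightarrow> 'f dual" where y: "\<And>u x. y u x = form x u" by metis
  have "cl2 d (\<lambda>k. cblinfun_apply \<phi> (S (z k))) \<le> P" if \<phi>: "norm \<phi> \<le> 1" for \<phi> :: "'e dual"
  proof (rule cl2_le_if_pairing_le)
    fix a
    have "(\<Sum>k<d. a k * \<phi> (S (z k))) = \<phi> (S (\<Sum>k<d. a k *\<^sub>C z k))"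
      by (simp add: cblinfun_apply_sum cblinfun_apply_scaleC scaleC_complex_def)
    also have "cmod \<dots> \<le> P * norm \<phi> * seminorm (\<Sum>k<d. a k *\<^sub>C z k)" by (rule S)
    also have "\<dots> \<le> P * 1 * cl2 d a"
      unfolding seminorm_combination[OF z(2)] using \<phi> P by (intro mult_right_mono mult_left_mono L2_set_nonneg) auto
    finally show "cmod (\<Sum>k<d. a k * \<phi> (S (z k))) \<le> P * cl2 d a" by simp
  qed (use P in simp)
  moreover have "cl2 d (\<lambda>k. cblinfun_apply \<Phi> (y (z k))) \<le> Q" if "norm \<Phi> \<le> 1" for \<Phi> :: "'f dual dual"
    by (rule cl2_bidual_le[OF _ _ that]) (use Q order_trans[OF bessel[OF z(2)] vQ] in \<open>simp_all add: y\<close>)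
  ultimately have "ennreal (cmod (\<Sum>k<d. y (z k) (T (S (z k))))) \<le> ennreal ((50 / 7)\<^sup>2 * (P * Q)) * amp_norm n min_mnorms max_mnorms T"
    by (rule pairing_le_amp_norm[OF z(1) P Q])
  then show ?thesis by (simp add: z(3) y)
qed

end

context hilbert_operator
begin

lemma seminorm_scale: "seminorm (c *\<^sub>C x) = cmod c * seminorm x"
proof -
  have "complex_of_real ((seminorm (c *\<^sub>C x))\<^sup>2) = c * (cnj c * of_real ((seminorm x)\<^sup>2))"
    unfolding form_self[symmetric] by (simp add: form_scale_left form_scale_right mult_ac)
  also have "\<dots> = of_real ((cmod c * seminorm x)\<^sup>2)"
    by (simp add: power_mult_distrib complex_norm_square del: of_real_power)
  finally have "(seminorm (c *\<^sub>C x))\<^sup>2 = (cmod c * seminorm x)\<^sup>2" by (simp only: of_real_eq_iff)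
  then show ?thesis by (simp add: seminorm_nonneg)
qed

lemma seminorm_le_norm_into:
  obtains Q where "Q \<ge> 0" "norm_into H v = ennreal Q" "\<And>x. seminorm x \<le> Q * norm x"
proof -
  obtain K where K: "\<And>x. seminorm x \<le> K * norm x"
    using v by (auto simp: bounded_into_def seminorm_def)
  have "norm_into H v \<le> ennreal \<bar>K\<bar>"
    unfolding norm_into_def
  proof (intro SUP_least ennreal_leI, clarify)
    fix x :: 'f assume "norm x \<le> 1"
    then have "\<bar>K\<bar> * norm x \<le> \<bar>K\<bar> * 1" by (intro mult_left_mono) auto
    moreover have "K * norm x \<le> \<bar>K\<bar> * norm x" by (intro mult_right_mono) auto
    ultimately show "hnorm H (v x) \<le> \<bar>K\<bar>" using K[of x] by (simp add: seminorm_def)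
  qed
  then have "norm_into H v < Orderings.top" by (rule le_less_trans) simp
  then obtain Q where Q: "Q \<ge> 0" "norm_into H v = ennreal Q" by (cases "norm_into H v") auto
  have "seminorm x \<le> Q * norm x" for x
  proof (cases "x = 0")
    case True
    then show ?thesis using K[of 0] by simp
  next
    case False
    let ?c = "complex_of_real (1 / norm x)"
    have "ennreal (hnorm H (v (?c *\<^sub>C x))) \<le> norm_into H v"
      unfolding norm_into_def using False by (intro SUP_upper) (simp add: norm_scaleC norm_divide)
    then have "seminorm (?c *\<^sub>C x) \<le> Q" using Q by (simp add: seminorm_def)
    then show ?thesis using False by (simp add: seminorm_scale norm_divide field_simps)
  qed
  with Q that show ?thesis by blast
qed

lemma norm_le_norm_from:
  assumes u: "bounded_from H u"
  obtains P where "P \<ge> 0" "norm_from H u = ennreal P" "\<And>x. norm (u (v x)) \<le> P * seminorm x"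
proof -
  obtain K where K: "\<And>h. h \<in> hcarrier H \<Longrightarrow> norm (u h) \<le> K * hnorm H h"
    using u unfolding bounded_from_def by blast
  have "norm_from H u \<le> ennreal \<bar>K\<bar>"
    unfolding norm_from_def
  proof (intro SUP_least ennreal_leI, clarify)
    fix h assume h: "h \<in> hcarrier H" "hnorm H h \<le> 1"
    have "0 \<le> hnorm H h" using inner_self_nonneg[OF h(1)] by (simp add: hnorm_def)
    then have "K * hnorm H h \<le> \<bar>K\<bar> * hnorm H h" by (intro mult_right_mono) auto
    also have "\<dots> \<le> \<bar>K\<bar> * 1" using h by (intro mult_left_mono) auto
    finally show "norm (u h) \<le> \<bar>K\<bar>" using K[OF h(1)] by simp
  qed
  then have "norm_from H u < Orderings.top" by (rule le_less_trans) simp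
  then obtain P where P: "P \<ge> 0" "norm_from H u = ennreal P" by (cases "norm_from H u") auto
  have "norm (u (v x)) \<le> P * seminorm x" for x
  proof (cases "seminorm x = 0")
    case True
    then show ?thesis using K[OF v_closed, of x] by (simp add: seminorm_def)
  next
    case False
    then have r: "seminorm x > 0" using seminorm_nonneg[of x] by simp
    let ?c = "complex_of_real (1 / seminorm x)"
    have "hnorm H (v (?c *\<^sub>C x)) = 1"
      using r seminorm_scale[of ?c x] by (simp add: norm_divide flip: seminorm_def)
    then have "ennreal (norm (u (v (?c *\<^sub>C x)))) \<le> norm_from H u"
      unfolding norm_from_def by (intro SUP_upper) (simp add: v_closed)
    then have "norm (u (v (?c *\<^sub>C x))) \<le> P" using P by simp
    moreover have "u (v (?c *\<^sub>C x)) = ?c *\<^sub>C u (v x)"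
      using u v v_closed[of x] unfolding bounded_from_def bounded_into_def by metis
    ultimately show ?thesis using r by (simp add: norm_scaleC norm_divide field_simps)
  qed
  with P that show ?thesis by blast
qed

end

text \<open>
  Any factorization with \<open>\<parallel>u\<parallel> \<parallel>v\<parallel> < 2\<close> suffices, since \<open>3 (50/7)\<^sup>2 < 170\<close> leaves room for the
  small \<open>\<delta>\<close> that makes both constants strictly positive.
\<close>
lemma gamma2_star_le_amp_norm:
  fixes T :: "'e::complex_normed_vector \<Rightarrow>\<^sub>C\<^sub>L 'f::complex_normed_vector"
  assumes T: "rank_at_most T n"
  shows "gamma2_star T \<le> 170 * amp_norm n min_mnorms max_mnorms T"
  unfolding gamma2_star_def
proof (rule SUP_least, clarify)
  fix S :: "'f \<Rightarrow>\<^sub>C\<^sub>L 'e"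
  assume "gamma2 S \<le> 1"
  then have "gamma2 S < 2" by (rule le_less_trans) simp
  then obtain H :: "('f \<Rightarrow> complex) hspace" and u v where
    fact: "hilbert_factorization S H u v" and lt: "norm_from H u * norm_into H v < 2"
    unfolding gamma2_def Inf_less_iff by auto
  interpret hilbert_space H using fact by (simp add: hilbert_factorization_def)
  interpret hilbert_operator H v using fact by unfold_locales (simp add: hilbert_factorization_def)
  have u: "bounded_from H u" and uv: "bidual_embed (S x) = u (v x)" for x
    using fact by (auto simp: hilbert_factorization_def)
  obtain Q where Q: "Q \<ge> 0" "norm_into H v = ennreal Q" "\<And>x. seminorm x \<le> Q * norm x"
    by (rule seminorm_le_norm_into) (rule that, assumption+)
  obtain P where P: "P \<ge> 0" "norm_from H u = ennreal P" "\<And>x. norm (u (v x)) \<le> P * seminorm x"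
    by (rule norm_le_norm_from[OF u]) (rule that, assumption+)
  have PQ: "P * Q < 2"
    using lt P(1) Q(1) unfolding P(2) Q(2) by (simp add: ennreal_less_iff flip: ennreal_mult' ennreal_numeral)
  define \<delta> where "\<delta> = 1 / (P + Q + 1)"
  have \<delta>: "\<delta> > 0" "\<delta> \<le> 1" "\<delta> * (P + Q + 1) = 1" using P(1) Q(1) by (simp_all add: \<delta>_def)
  have "(P + \<delta>) * (Q + \<delta>) = P * Q + \<delta> * (P + Q + \<delta>)" by (simp add: algebra_simps)
  also have "\<dots> \<le> 2 + \<delta> * (P + Q + 1)" using PQ \<delta> by (intro add_mono mult_left_mono) auto
  finally have pq: "(P + \<delta>) * (Q + \<delta>) \<le> 3" using \<delta>(3) by simp
  have "ennreal (cmod (ctrace (S o\<^sub>C\<^sub>L T))) \<le> ennreal ((50 / 7)\<^sup>2 * ((P + \<delta>) * (Q + \<delta>))) * amp_norm n min_mnorms max_mnorms T"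
  proof (rule ctrace_le_amp_norm[OF T])
    fix \<phi> :: "'e dual" and x
    have "cmod (\<phi> (S x)) = cmod (u (v x) \<phi>)" by (simp flip: uv add: bidual_embed_apply)
    also have "\<dots> \<le> norm (u (v x)) * norm \<phi>" by (rule norm_cblinfun)
    also have "\<dots> \<le> ((P + \<delta>) * seminorm x) * norm \<phi>"
      using P(3)[of x] \<delta>(1) seminorm_nonneg[of x]
      by (intro mult_right_mono) (auto simp: distrib_right intro: order_trans)
    finally show "cmod (\<phi> (S x)) \<le> (P + \<delta>) * norm \<phi> * seminorm x" by (simp add: mult_ac)
  next
    fix x
    show "seminorm x \<le> (Q + \<delta>) * norm x" using Q(3)[of x] \<delta>(1) by (simp add: distrib_right add_increasing2)
  qed (use P(1) Q(1) \<delta>(1) in auto)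
  also have "\<dots> \<le> ennreal 170 * amp_norm n min_mnorms max_mnorms T"
    using pq by (intro mult_right_mono ennreal_leI) (auto simp: power2_eq_square)
  finally show "ennreal (cmod (ctrace (S o\<^sub>C\<^sub>L T))) \<le> 170 * amp_norm n min_mnorms max_mnorms T" by simp
qed

section \<open>Determinants\<close>

text \<open>
  The determinant as a function of the entries only: the dimension is a number, and continuity in the
  entries refers to the product topology.
\<close>
definition cdet :: "nat \<Rightarrow> (nat \<Rightarrow> nat \<Rightarrow> complex) \<Rightarrow> complex" where
  "cdet n A = Determinant.det (Matrix.mat n n (\<lambda>(i, j). A i j))"

lemma cdet_mult: "cdet n (\<lambda>i j. \<Sum>k<n. A i k * B k j) = cdet n A * cdet n B"
proof -
  have "Matrix.mat n n (\<lambda>(i, j). \<Sum>k<n. A i k * B k j)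
    = Matrix.mat n n (\<lambda>(i, j). A i j) * Matrix.mat n n (\<lambda>(i, j). B i j)"
    by (intro eq_matI) (auto simp: scalar_prod_def atLeast0LessThan)
  then show ?thesis
    unfolding cdet_def by (simp only:) (rule det_mult[of _ n]; simp)
qed

lemma cdet_scale: "cdet n (\<lambda>i j. c * A i j) = c ^ n * cdet n A"
proof -
  have "Matrix.mat n n (\<lambda>(i, j). c * A i j) = c \<cdot>\<^sub>m Matrix.mat n n (\<lambda>(i, j). A i j)"
    by (intro eq_matI) auto
  then show ?thesis unfolding cdet_def by simp
qed

lemma cdet_identity: "cdet n (\<lambda>i j. if i = j then 1 else 0) = 1"
proof -
  have "Matrix.mat n n (\<lambda>(i, j). if i = j then 1 else 0) = (1\<^sub>m n :: complex mat)"
    by (intro eq_matI) auto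
  then show ?thesis unfolding cdet_def by simp
qed

text \<open>
  Clear either off-diagonal block of the bordered matrix \<open>((I, -p), (q, 1))\<close> by a unipotent block
  matrix: the two resulting block triangular matrices have the two sides as their determinants.
\<close>
lemma cdet_rank_one_update:
  "cdet n (\<lambda>i j. (if i = j then 1 else 0) + p i * q j) = 1 + (\<Sum>i<n. p i * q i)"
proof -
  define I where "I = (1\<^sub>m n :: complex mat)"
  define M where "M = Matrix.mat n n (\<lambda>(i, j). (if i = j then 1 else 0) + p i * q j)"
  define P where "P = Matrix.mat n 1 (\<lambda>(i, j). p i)"
  define P' where "P' = Matrix.mat n 1 (\<lambda>(i, j). - p i)"
  define Q where "Q = Matrix.mat 1 n (\<lambda>(i, j). q j)"
  define Q' where "Q' = Matrix.mat 1 n (\<lambda>(i, j). - q j)"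
  define S where "S = Matrix.mat 1 1 (\<lambda>(i, j). 1 + (\<Sum>i<n. p i * q i))"
  define E where "E = (1\<^sub>m 1 :: complex mat)"
  define Z where "Z = (0\<^sub>m 1 n :: complex mat)"
  define W where "W = (0\<^sub>m n 1 :: complex mat)"
  note defs = I_def M_def P_def P'_def Q_def Q'_def S_def E_def Z_def W_def
  have c: "I \<in> carrier_mat n n" "M \<in> carrier_mat n n" "P \<in> carrier_mat n 1" "P' \<in> carrier_mat n 1"
    "Q \<in> carrier_mat 1 n" "Q' \<in> carrier_mat 1 n" "S \<in> carrier_mat 1 1" "E \<in> carrier_mat 1 1"
    "Z \<in> carrier_mat 1 n" "W \<in> carrier_mat n 1"
    by (simp_all add: defs)
  define X where "X = four_block_mat I P' Q E"
  have X: "X \<in> carrier_mat (n + 1) (n + 1)" unfolding X_def by (rule four_block_carrier_mat[OF c(1) c(8)])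
  have "four_block_mat I P Z E * X = four_block_mat (I * I + P * Q) (I * P' + P * E) (Z * I + E * Q) (Z * P' + E * E)"
    unfolding X_def by (rule mult_four_block_mat[of _ n n _ 1 _ 1]) (use c in auto)
  also have "\<dots> = four_block_mat M W Q E"
  proof -
    have "I * I + P * Q = M" by (intro eq_matI) (auto simp: defs scalar_prod_def)
    moreover have "I * P' + P * E = W" by (intro eq_matI) (auto simp: defs scalar_prod_def)
    moreover have "Z * I + E * Q = Q" by (intro eq_matI) (auto simp: defs scalar_prod_def)
    moreover have "Z * P' + E * E = E" by (intro eq_matI) (auto simp: defs scalar_prod_def)
    ultimately show ?thesis by simp
  qed
  finally have "Determinant.det (four_block_mat I P Z E) * Determinant.det X = Determinant.det (four_block_mat M W Q E)"
    using det_mult[of "four_block_mat I P Z E" "n + 1" X] X four_block_carrier_mat[OF c(1) c(8), of P Z] by simp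
  moreover have "Determinant.det (four_block_mat I P Z E) = 1"
    using det_four_block_mat_lower_left_zero[OF c(1) c(3) _ c(8), of Z] by (simp add: I_def E_def Z_def)
  moreover have "Determinant.det (four_block_mat M W Q E) = Determinant.det M"
    using det_four_block_mat_upper_right_zero[OF c(2) _ c(5) c(8), of W] by (simp add: E_def W_def)
  ultimately have 1: "Determinant.det X = Determinant.det M" by simp
  have "four_block_mat I W Q' E * X = four_block_mat (I * I + W * Q) (I * P' + W * E) (Q' * I + E * Q) (Q' * P' + E * E)"
    unfolding X_def by (rule mult_four_block_mat[of _ n n _ 1 _ 1]) (use c in auto)
  also have "\<dots> = four_block_mat I P' Z S"
  proof -
    have "I * I + W * Q = I" by (intro eq_matI) (auto simp: defs scalar_prod_def)
    moreover have "I * P' + W * E = P'" by (intro eq_matI) (auto simp: defs scalar_prod_def)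
    moreover have "Q' * I + E * Q = Z" by (intro eq_matI) (auto simp: defs scalar_prod_def)
    moreover have "Q' * P' + E * E = S"
      by (intro eq_matI) (auto simp: defs scalar_prod_def atLeast0LessThan mult.commute)
    ultimately show ?thesis by simp
  qed
  finally have "Determinant.det (four_block_mat I W Q' E) * Determinant.det X = Determinant.det (four_block_mat I P' Z S)"
    using det_mult[of "four_block_mat I W Q' E" "n + 1" X] X four_block_carrier_mat[OF c(1) c(8), of W Q'] by simp
  moreover have "Determinant.det (four_block_mat I W Q' E) = 1"
    using det_four_block_mat_upper_right_zero[OF c(1) _ c(6) c(8), of W] by (simp add: I_def E_def W_def)
  moreover have "Determinant.det (four_block_mat I P' Z S) = 1 + (\<Sum>i<n. p i * q i)"
    using det_four_block_mat_lower_left_zero[OF c(1) c(4) _ c(7), of Z] by (simp add: I_def Z_def det_single[OF c(7)]) (simp add: S_def)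
  ultimately show ?thesis using 1 by (simp add: cdet_def M_def)
qed

lemma cdet_inverse:
  assumes "cdet n A \<noteq> 0"
  obtains D where "\<And>i j. i < n \<Longrightarrow> j < n \<Longrightarrow> (\<Sum>k<n. A i k * D k j) = (if i = j then 1 else 0)"
    "\<And>i j. i < n \<Longrightarrow> j < n \<Longrightarrow> (\<Sum>k<n. D i k * A k j) = (if i = j then 1 else 0)"
proof -
  define M where "M = Matrix.mat n n (\<lambda>(i, j). A i j)"
  have M: "M \<in> carrier_mat n n" by (simp add: M_def)
  note adj = adj_mat[OF M]
  define D where "D i j = adj_mat M $$ (i, j) / Determinant.det M" for i j
  have d: "Determinant.det M \<noteq> 0" using assms by (simp add: cdet_def M_def)
  have dim: "dim_row M = n" "dim_col M = n" "dim_row (adj_mat M) = n" "dim_col (adj_mat M) = n"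
    using carrier_matD[OF M] carrier_matD[OF adj(1)] by auto
  have entry: "M $$ (i, j) = A i j" if "i < n" "j < n" for i j using that by (simp add: M_def)
  show ?thesis
  proof (rule that[of D])
    fix i j assume ij: "i < n" "j < n"
    have "(\<Sum>k<n. A i k * D k j) = (M * adj_mat M) $$ (i, j) / Determinant.det M"
      using ij by (simp add: scalar_prod_def atLeast0LessThan D_def sum_divide_distrib dim entry)
    then show "(\<Sum>k<n. A i k * D k j) = (if i = j then 1 else 0)"
      unfolding adj(2) using ij d by simp
    have "(\<Sum>k<n. D i k * A k j) = (adj_mat M * M) $$ (i, j) / Determinant.det M"
      using ij by (simp add: scalar_prod_def atLeast0LessThan D_def sum_divide_distrib dim entry)
    then show "(\<Sum>k<n. D i k * A k j) = (if i = j then 1 else 0)"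
      unfolding adj(3) using ij d by simp
  qed
qed

lemma continuous_on_cdet: "continuous_on UNIV (\<lambda>A :: nat \<times> nat \<Rightarrow> complex. cdet n (\<lambda>i j. A (i, j)))"
proof -
  have "cdet n (\<lambda>i j. A (i, j)) = (\<Sum>p | p permutes {0..<n}. signof p * (\<Prod>i = 0..<n. A (i, p i)))" for A
    unfolding cdet_def by (subst det_def'[of _ n]) (auto intro!: sum.cong prod.cong simp: permutes_in_image)
  then show ?thesis by (simp only:) (intro continuous_intros continuous_on_product_coordinates)
qed

section \<open>John's theorem\<close>

text \<open>
  To first order in \<open>e\<close> the product is \<open>1 + e (s - n)\<close>. The value of \<open>e\<close> below keeps the
  quadratic term under half of the linear one, and Bernoulli's inequality handles the power.
\<close>
lemma exists_volume_increase:
  fixes s :: real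
  assumes "s > real n" "n \<ge> 1"
  obtains e where "0 < e" "e < 1" "(1 - e) ^ n * (1 + e * s / (1 - e)) > 1"
proof -
  obtain N where N: "n = Suc N" using assms(2) by (cases n) auto
  define e where "e = (s - n) / (2 * n * s)"
  have s: "s > 1" using assms by simp
  have "s * 1 \<le> s * n" using assms s by (intro mult_left_mono) auto
  then have "s - n \<le> s * n" using assms s by linarith
  then have e: "0 < e" "e \<le> 1 / 2"
    unfolding e_def using assms s by (simp, subst pos_divide_le_eq) (simp_all add: mult_ac)
  have "real N * (e * (s - 1)) \<le> real n * (e * s)" using e s by (intro mult_mono) (auto simp: N)
  also have "\<dots> < s - n" using assms s by (simp add: e_def field_simps)
  finally have gap: "real N * (e * (s - 1)) < s - 1 - real N" by (simp add: N)
  have "1 < (1 - real N * e) * (1 + e * (s - 1))"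
  proof -
    have "(1 - real N * e) * (1 + e * (s - 1)) = 1 + e * (s - 1 - real N - real N * (e * (s - 1)))"
      by (simp add: algebra_simps)
    moreover have "0 < e * (s - 1 - real N - real N * (e * (s - 1)))" using e(1) gap by (intro mult_pos_pos) auto
    ultimately show ?thesis by linarith
  qed
  also have "\<dots> \<le> (1 - e) ^ N * (1 + e * (s - 1))"
    using Bernoulli_inequality[of "- e" N] e s by (intro mult_right_mono) auto
  also have "\<dots> = (1 - e) ^ n * (1 + e * s / (1 - e))"
    using e by (simp add: N field_simps)
  finally show ?thesis using that[of e] e by simp
qed

lemma sum_mult_cnj: "(\<Sum>k<n. a k * cnj (a k)) = complex_of_real ((cl2 n a)\<^sup>2)"
  by (simp only: cl2_square of_real_sum complex_norm_square)

text \<open>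
  The operator \<open>I + t p p\<^sup>*\<close> multiplies the component along the unit vector \<open>p\<close> by \<open>1 + t\<close> and fixes
  its orthogonal complement.
\<close>
lemma cl2_rank_one_update:
  fixes w p :: "nat \<Rightarrow> complex" and t :: real
  assumes p: "cl2 n p = 1"
  shows "(cl2 n (\<lambda>k. w k + t * p k * (\<Sum>l<n. cnj (p l) * w l)))\<^sup>2
    = (cl2 n w)\<^sup>2 + ((1 + t)\<^sup>2 - 1) * (cmod (\<Sum>l<n. cnj (p l) * w l))\<^sup>2"
proof -
  define f where "f = (\<Sum>l<n. cnj (p l) * w l)"
  have pp: "(\<Sum>k<n. p k * cnj (p k)) = 1"
    using p by (simp only: sum_mult_cnj) simp
  have fc: "(\<Sum>k<n. w k * cnj (p k)) = f" "(\<Sum>k<n. p k * cnj (w k)) = cnj f"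
    by (simp_all add: f_def mult.commute)
  have "complex_of_real ((cl2 n (\<lambda>k. w k + t * p k * f))\<^sup>2) = (\<Sum>k<n. (w k + t * p k * f) * cnj (w k + t * p k * f))"
    by (rule sum_mult_cnj[symmetric])
  also have "\<dots> = (\<Sum>k<n. w k * cnj (w k)) + t * cnj f * (\<Sum>k<n. w k * cnj (p k))
      + t * f * (\<Sum>k<n. p k * cnj (w k)) + t\<^sup>2 * (f * cnj f) * (\<Sum>k<n. p k * cnj (p k))"
    unfolding sum_distrib_left sum.distrib[symmetric]
    by (intro sum.cong refl) (simp add: algebra_simps power2_eq_square)
  also have "\<dots> = (\<Sum>k<n. w k * cnj (w k)) + ((1 + t)\<^sup>2 - 1) * (f * cnj f)"
    unfolding pp fc by (simp add: algebra_simps power2_eq_square)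
  also have "\<dots> = complex_of_real ((cl2 n w)\<^sup>2 + ((1 + t)\<^sup>2 - 1) * (cmod f)\<^sup>2)"
    unfolding sum_mult_cnj unfolding complex_norm_square[symmetric] by simp
  finally show ?thesis unfolding f_def by (simp only: of_real_eq_iff)
qed

text \<open>
  John's theorem in the dual form that the pairing argument needs. Among the systems of \<open>n\<close> functionals with
  \<open>\<Sum> |\<psi>\<^sub>k(z)|\<^sup>2 \<le> \<parallel>z\<parallel>\<^sup>2\<close> take one whose coefficient matrix \<open>A\<close> has a determinant of maximal modulus, and let \<open>x\<^sub>k\<close> be
  the basis dual to it. A functional \<open>\<phi>\<close> of norm at most \<open>1\<close> has coordinates \<open>\<phi>(x\<^sub>k)\<close> in the basis \<open>\<psi>\<^sub>k\<close>.
  Suppose that their square sum \<open>s\<^sup>2\<close> exceeds \<open>n\<close>. The quadratic form \<open>(1 - e) \<Sum> |\<psi>\<^sub>k(z)|\<^sup>2 + e |\<phi>(z)|\<^sup>2\<close> is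
  still at most \<open>\<parallel>z\<parallel>\<^sup>2\<close>, and it is the square sum of the system obtained from \<open>\<psi>\<close> by the matrix
  \<open>\<surd>(1 - e) (I + t p p\<^sup>*)\<close> with \<open>p\<close> in the direction of \<open>\<phi>\<close>. The determinant of this matrix has square
  \<open>(1 - e)\<^sup>n (1 + e s\<^sup>2 / (1 - e))\<close>, which is greater than \<open>1\<close> for small \<open>e\<close>. This contradicts maximality.
\<close>
lemma john_biorthogonal_system:
  assumes dim: "has_cdim (UNIV :: 'g::complex_normed_vector set) n"
  obtains x :: "nat \<Rightarrow> 'g::complex_normed_vector" and \<psi> :: "nat \<Rightarrow> 'g::complex_normed_vector dual" where
    "\<And>k. k < n \<Longrightarrow> \<psi> k (x k) = 1"
    "\<And>z. cl2 n (\<lambda>k. cblinfun_apply (\<psi> k) z) \<le> norm z"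
    "\<And>\<phi> :: 'g::complex_normed_vector dual. norm \<phi> \<le> 1 \<Longrightarrow> cl2 n (\<lambda>k. cblinfun_apply \<phi> (x k)) \<le> sqrt n"
proof (cases "n = 0")
  case True
  show ?thesis by (rule that[of "\<lambda>_. 0" "\<lambda>_. 0"]) (simp_all add: True)
next
  case False
  then have n: "n \<ge> 1" by simp
  obtain B :: "'g set" where B: "finite B" "card B = n" "\<not> cdependent B" "cspan B = UNIV"
    using dim by (auto simp: has_cdim_def)
  obtain b where b: "bij_betw b {..<n} B"
    using ex_bij_betw_nat_finite[OF B(1)] B(2) by (auto simp: atLeast0LessThan)
  have bB: "b j \<in> B" if "j < n" for j using b that by (auto simp: bij_betw_def)
  define \<beta> where "\<beta> j x = crepresentation B x (b j)" for j x
  have \<beta>_add: "\<beta> j (x + y) = \<beta> j x + \<beta> j y" and \<beta>_scale: "\<beta> j (c *\<^sub>C x) = c * \<beta> j x" for j x y c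
    using B(3,4) by (simp_all add: \<beta>_def complex_vector.representation_add complex_vector.representation_scale)
  have \<beta>_b: "\<beta> j (b i) = (if i = j then 1 else 0)" if "i < n" "j < n" for i j
    using B(3) bB that b by (auto simp: \<beta>_def complex_vector.representation_basis bij_betw_def inj_on_eq_iff)
  have expand: "(\<Sum>j<n. \<beta> j x *\<^sub>C b j) = x" for x
  proof -
    have "(\<Sum>j<n. \<beta> j x *\<^sub>C b j) = (\<Sum>v\<in>B. crepresentation B x v *\<^sub>C v)"
      unfolding \<beta>_def by (rule sum.reindex_bij_betw[OF b])
    then show ?thesis using complex_vector.sum_representation_eq[OF B(3) _ B(1) subset_refl, of x] B(4) by simp
  qed
  obtain K where K: "K \<ge> 0" "\<And>c v. v \<in> B \<Longrightarrow> cmod (c v) \<le> K * norm (\<Sum>v\<in>B. c v *\<^sub>C v)"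
    using coordinates_bounded[OF B(1,3)] by metis
  have \<beta>_le: "cmod (\<beta> j x) \<le> K * norm x" if "j < n" for j x
    using K(2)[OF bB[OF that], of "crepresentation B x"] B(4)
      complex_vector.sum_representation_eq[OF B(3) _ B(1) subset_refl, of x] by (simp add: \<beta>_def)
  define \<Psi> where "\<Psi> A k x = (\<Sum>j<n. A (k, j) * \<beta> j x)" for A :: "nat \<times> nat \<Rightarrow> complex" and k x
  define R where "R = (\<Sum>j<n. norm (b j))"
  define C where "C = {A. (\<forall>i. if i \<in> {..<n} \<times> {..<n} then cmod (A i) \<le> R else A i = 0)} \<inter> (\<Inter>x. {A. cl2 n (\<lambda>k. \<Psi> A k x) \<le> norm x})"
  have CI: "A \<in> C" if A: "\<And>x. cl2 n (\<lambda>k. \<Psi> A k x) \<le> norm x" "\<And>i j. \<not> (i < n \<and> j < n) \<Longrightarrow> A (i, j) = 0" for A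
  proof -
    have "cmod (A (i, j)) \<le> R" if ij: "i < n" "j < n" for i j
    proof -
      have "A (i, j) = \<Psi> A i (b j)"
      proof -
        have "\<Psi> A i (b j) = (\<Sum>l<n. if l = j then A (i, j) else 0)"
          unfolding \<Psi>_def using ij by (intro sum.cong) (auto simp: \<beta>_b)
        then show ?thesis using ij by simp
      qed
      also have "cmod \<dots> \<le> cl2 n (\<lambda>k. \<Psi> A k (b j))"
        using ij member_le_L2_set[of "{..<n}" i "\<lambda>k. cmod (\<Psi> A k (b j))"] by simp
      also have "\<dots> \<le> norm (b j)" by (rule A(1))
      also have "\<dots> \<le> R" unfolding R_def using ij by (intro member_le_sum) auto
      finally show ?thesis .
    qed
    with A show ?thesis by (auto simp: C_def)
  qed
  have "continuous_on UNIV (\<lambda>A. cl2 n (\<lambda>k. \<Psi> A k x))" for x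
    unfolding \<Psi>_def L2_set_def by (intro continuous_intros continuous_on_product_coordinates)
  then have "closed (\<Inter>x. {A. cl2 n (\<lambda>k. \<Psi> A k x) \<le> norm x})"
    by (intro closed_INT ballI closed_Collect_le continuous_on_const)
  then have C: "compact C"
    unfolding C_def by (intro compact_Int_closed compact_finite_support_box)
  define f where "f A = cmod (cdet n (\<lambda>i j. A (i, j)))" for A
  have cont: "continuous_on C f"
    unfolding f_def by (intro continuous_on_norm continuous_on_subset[OF continuous_on_cdet]) simp
  have cdet_cong: "cdet n A = cdet n A'" if "\<And>i j. i < n \<Longrightarrow> j < n \<Longrightarrow> A i j = A' i j" for A A'
    unfolding cdet_def using that by (intro arg_cong[of _ _ Determinant.det] Matrix.cong_mat) auto
  define r where "r = 1 / (n * K + 1)"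
  have "n * K + 1 > 0" using K(1) by (simp add: add_nonneg_pos)
  then have r: "r > 0" "r * (n * K) \<le> 1" by (simp_all add: r_def)
  define A0 where "A0 = (\<lambda>(i, j). if i < n \<and> i = j then of_real r else (0 :: complex))"
  (* A small multiple of the coordinate system is admissible; so the maximal determinant is not zero. *)
  have "A0 \<in> C"
  proof (rule CI)
    fix x
    have "cmod (\<Psi> A0 k x) \<le> r * (K * norm x)" if "k < n" for k
    proof -
      have "\<Psi> A0 k x = (\<Sum>j<n. if k = j then of_real r * \<beta> j x else 0)"
        unfolding \<Psi>_def A0_def using that by (intro sum.cong) auto
      then have "\<Psi> A0 k x = of_real r * \<beta> k x" using that by simp
      then show ?thesis using \<beta>_le[OF that, of x] r(1) by (simp add: norm_mult)
    qed
    then have "(\<Sum>k<n. cmod (\<Psi> A0 k x)) \<le> (\<Sum>k<n. r * (K * norm x))"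
      by (intro sum_mono) auto
    also have "\<dots> = r * (n * K) * norm x" by simp
    also have "\<dots> \<le> 1 * norm x" using r(2) by (intro mult_right_mono) auto
    finally show "cl2 n (\<lambda>k. \<Psi> A0 k x) \<le> norm x"
      using L2_set_le_sum[of "{..<n}" "\<lambda>k. cmod (\<Psi> A0 k x)"] by simp
  qed (auto simp: A0_def)
  obtain A where A: "A \<in> C" and max: "\<And>A'. A' \<in> C \<Longrightarrow> f A' \<le> f A"
    using continuous_attains_sup[OF C _ cont] \<open>A0 \<in> C\<close> by blast
  have "cdet n (\<lambda>i j. A0 (i, j)) = cdet n (\<lambda>i j. of_real r * (if i = j then 1 else 0))"
    by (rule cdet_cong) (simp add: A0_def)
  also have "\<dots> \<noteq> 0"
    unfolding cdet_scale cdet_identity using r(1) by simp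
  finally have "f A0 > 0" by (simp add: f_def)
  then have fA: "f A > 0" using max[OF \<open>A0 \<in> C\<close>] by simp
  then obtain D where D: "\<And>i j. i < n \<Longrightarrow> j < n \<Longrightarrow> (\<Sum>k<n. A (i, k) * D k j) = (if i = j then 1 else 0)"
    "\<And>i j. i < n \<Longrightarrow> j < n \<Longrightarrow> (\<Sum>k<n. D i k * A (k, j)) = (if i = j then 1 else 0)"
    using cdet_inverse[of n "\<lambda>i j. A (i, j)"] unfolding f_def by auto
  define x where "x l = (\<Sum>j<n. D j l *\<^sub>C b j)" for l
  have A_le: "cl2 n (\<lambda>k. \<Psi> A k z) \<le> norm z" for z using A by (auto simp: C_def)
  have \<Psi>_add: "\<Psi> A k (y + z) = \<Psi> A k y + \<Psi> A k z" and \<Psi>_scale: "\<Psi> A k (c *\<^sub>C y) = c * \<Psi> A k y" for k y z c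
    by (simp_all add: \<Psi>_def \<beta>_add \<beta>_scale distrib_left sum.distrib sum_distrib_left mult_ac)
  have "\<exists>\<psi> :: 'g dual. \<forall>z. \<psi> z = \<Psi> A k z" if k: "k < n" for k
  proof -
    have "cmod (\<Psi> A k z) \<le> 1 * norm z" for z
      using member_le_L2_set[of "{..<n}" k "\<lambda>k. cmod (\<Psi> A k z)"] A_le[of z] k by simp
    then show ?thesis
      by (metis exists_cblinfun[of "\<Psi> A k"] \<Psi>_add \<Psi>_scale scaleC_complex_def)
  qed
  then obtain \<psi> :: "nat \<Rightarrow> 'g dual" where \<psi>: "\<And>k z. k < n \<Longrightarrow> \<psi> k z = \<Psi> A k z" by metis
  have \<beta>_x: "\<beta> i (x l) = D i l" if "i < n" for i l
  proof -
    have \<beta>_sum: "\<beta> i (\<Sum>j\<in>I. g j) = (\<Sum>j\<in>I. \<beta> i (g j))" for g and I :: "nat set"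
      by (induction I rule: infinite_finite_induct) (use \<beta>_scale[of i 0 0] in \<open>simp_all add: \<beta>_add complex_vector.scale_zero_left\<close>)
    have "\<beta> i (x l) = (\<Sum>j<n. if j = i then D j l else 0)"
      unfolding x_def \<beta>_sum using that by (intro sum.cong) (auto simp: \<beta>_scale \<beta>_b)
    then show ?thesis using that by simp
  qed
  have dual: "\<Psi> A k (x l) = (if k = l then 1 else 0)" if "k < n" "l < n" for k l
  proof -
    have "\<Psi> A k (x l) = (\<Sum>j<n. A (k, j) * D j l)"
      unfolding \<Psi>_def by (intro sum.cong) (simp_all add: \<beta>_x)
    then show ?thesis using D(1)[OF that] by simp
  qed
  have recon: "(\<Sum>l<n. \<Psi> A l z *\<^sub>C x l) = z" for z
  proof -
    have "(\<Sum>l<n. \<Psi> A l z *\<^sub>C x l) = (\<Sum>l<n. \<Sum>i<n. (\<Psi> A l z * D i l) *\<^sub>C b i)"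
      unfolding x_def complex_vector.scale_sum_right scaleC_scaleC ..
    also have "\<dots> = (\<Sum>i<n. (\<Sum>l<n. \<Psi> A l z * D i l) *\<^sub>C b i)"
      unfolding complex_vector.scale_sum_left by (rule sum.swap)
    also have "\<dots> = (\<Sum>i<n. \<beta> i z *\<^sub>C b i)"
    proof (intro sum.cong refl arg_cong2[of _ _ _ _ scaleC])
      fix i assume i: "i \<in> {..<n}"
      have "(\<Sum>l<n. \<Psi> A l z * D i l) = (\<Sum>l<n. \<Sum>j<n. D i l * A (l, j) * \<beta> j z)"
        unfolding \<Psi>_def sum_distrib_right by (intro sum.cong refl) (simp add: mult_ac)
      also have "\<dots> = (\<Sum>j<n. (\<Sum>l<n. D i l * A (l, j)) * \<beta> j z)"
        unfolding sum_distrib_right by (rule sum.swap)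
      also have "\<dots> = (\<Sum>j<n. if i = j then \<beta> j z else 0)"
        using i D(2) by (intro sum.cong) auto
      finally show "(\<Sum>l<n. \<Psi> A l z * D i l) = \<beta> i z" using i by simp
    qed
    finally show ?thesis by (simp add: expand)
  qed
  show ?thesis
  proof (rule that[of \<psi> x])
    show "\<psi> k (x k) = 1" if "k < n" for k using that by (simp add: \<psi> dual)
    show "cl2 n (\<lambda>k. cblinfun_apply (\<psi> k) z) \<le> norm z" for z
      using A_le[of z] by (simp add: \<psi> L2_set_def)
    fix \<phi> :: "'g dual" assume \<phi>: "norm \<phi> \<le> 1"
    define c where "c l = \<phi> (x l)" for l
    have \<phi>_eq: "\<phi> z = (\<Sum>l<n. c l * \<Psi> A l z)" for z
      using arg_cong[OF recon[of z], of "cblinfun_apply \<phi>"]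
      by (simp add: cblinfun_apply_sum cblinfun_apply_scaleC scaleC_complex_def c_def mult.commute)
    have "(cl2 n c)\<^sup>2 \<le> n"
    proof (rule ccontr)
      assume large: "\<not> (cl2 n c)\<^sup>2 \<le> n"
      define s where "s = cl2 n c"
      have sn: "s\<^sup>2 > n" using large by (simp add: s_def)
      have "s \<noteq> 0" using sn by auto
      moreover have "s \<ge> 0" by (simp add: s_def L2_set_nonneg)
      ultimately have s0: "s > 0" by simp
      obtain e where e: "0 < e" "e < 1" "(1 - e) ^ n * (1 + e * s\<^sup>2 / (1 - e)) > 1"
        by (rule exists_volume_increase[OF sn n])
      (* This t turns the coefficient (1 - e) ((1 + t)^2 - 1) / s^2 of |phi(z)|^2 into e. *)
      define t where "t = sqrt (1 + e * s\<^sup>2 / (1 - e)) - 1"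
      have t: "(1 + t)\<^sup>2 = 1 + e * s\<^sup>2 / (1 - e)" "1 + t \<ge> 0" using e by (simp_all add: t_def)
      define p where "p l = cnj (c l) / of_real s" for l
      have p: "cl2 n p = 1"
        using s0 cl2_scale[where n = n and c = "1 / of_real s" and a = "\<lambda>l. cnj (c l)"] by (simp add: p_def norm_divide s_def[symmetric])
      define L where "L i j = of_real (sqrt (1 - e)) * ((if i = j then 1 else 0) + (of_real t * p i) * cnj (p j))" for i j
      define A' where "A' = (\<lambda>(i, j). if i < n \<and> j < n then \<Sum>k<n. L i k * A (k, j) else 0)"
      have \<Psi>A': "\<Psi> A' i z = of_real (sqrt (1 - e)) * (\<Psi> A i z + t * p i * (\<Sum>l<n. cnj (p l) * \<Psi> A l z))" if i: "i < n" for i z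
      proof -
        have "\<Psi> A' i z = (\<Sum>j<n. \<Sum>k<n. L i k * (A (k, j) * \<beta> j z))"
          unfolding \<Psi>_def using i by (intro sum.cong refl) (simp add: A'_def sum_distrib_right mult.assoc)
        also have "\<dots> = (\<Sum>k<n. L i k * \<Psi> A k z)"
          unfolding \<Psi>_def sum_distrib_left by (rule sum.swap)
        also have "\<dots> = (\<Sum>k<n. of_real (sqrt (1 - e)) * ((if i = k then \<Psi> A k z else 0) + t * p i * (cnj (p k) * \<Psi> A k z)))"
          by (intro sum.cong refl) (simp add: L_def algebra_simps)
        also have "\<dots> = of_real (sqrt (1 - e)) * (\<Psi> A i z + t * p i * (\<Sum>l<n. cnj (p l) * \<Psi> A l z))"
          using i by (simp add: sum_distrib_left[symmetric] sum.distrib)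
        finally show ?thesis .
      qed
      have "A' \<in> C"
      proof (rule CI)
        fix z
        have pf: "(\<Sum>l<n. cnj (p l) * \<Psi> A l z) = \<phi> z / of_real s"
          by (simp add: \<phi>_eq p_def sum_divide_distrib)
        have "cl2 n (\<lambda>k. \<Psi> A' k z) = cl2 n (\<lambda>k. of_real (sqrt (1 - e)) * (\<Psi> A k z + t * p k * (\<Sum>l<n. cnj (p l) * \<Psi> A l z)))"
          by (simp add: L2_set_def \<Psi>A')
        also have "\<dots> = sqrt (1 - e) * cl2 n (\<lambda>k. \<Psi> A k z + t * p k * (\<Sum>l<n. cnj (p l) * \<Psi> A l z))"
          using e by (subst cl2_scale) simp
        finally have "(cl2 n (\<lambda>k. \<Psi> A' k z))\<^sup>2
          = (1 - e) * (cl2 n (\<lambda>k. \<Psi> A k z + t * p k * (\<Sum>l<n. cnj (p l) * \<Psi> A l z)))\<^sup>2"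
          using e(2) by (simp only: power_mult_distrib) simp
        also have "\<dots> = (1 - e) * ((cl2 n (\<lambda>k. \<Psi> A k z))\<^sup>2 + ((1 + t)\<^sup>2 - 1) * (cmod (\<phi> z / of_real s))\<^sup>2)"
          by (subst cl2_rank_one_update[OF p]) (simp only: pf)
        also have "\<dots> = (1 - e) * (cl2 n (\<lambda>k. \<Psi> A k z))\<^sup>2 + e * (cmod (\<phi> z))\<^sup>2"
          using e s0 by (simp add: t norm_divide field_simps)
        also have "\<dots> \<le> (1 - e) * (norm z)\<^sup>2 + e * (norm z)\<^sup>2"
        proof (intro add_mono mult_left_mono power_mono)
          show "cmod (\<phi> z) \<le> norm z"
            using norm_cblinfun[of \<phi> z] mult_right_mono[OF \<phi>, of "norm z"] by simp
        qed (use e A_le L2_set_nonneg in auto)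
        finally have "(cl2 n (\<lambda>k. \<Psi> A' k z))\<^sup>2 \<le> (norm z)\<^sup>2" by (simp add: algebra_simps)
        then show "cl2 n (\<lambda>k. \<Psi> A' k z) \<le> norm z" by (rule power2_le_imp_le) simp
      qed (auto simp: A'_def)
      have "cdet n (\<lambda>i j. A' (i, j)) = cdet n (\<lambda>i j. \<Sum>k<n. L i k * A (k, j))"
        by (rule cdet_cong) (simp add: A'_def)
      also have "\<dots> = cdet n L * cdet n (\<lambda>i j. A (i, j))" by (rule cdet_mult)
      also have "cdet n L = of_real (sqrt (1 - e)) ^ n * (1 + (\<Sum>i<n. (of_real t * p i) * cnj (p i)))"
        unfolding L_def cdet_scale cdet_rank_one_update ..
      also have "(\<Sum>i<n. (of_real t * p i) * cnj (p i)) = of_real t"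
      proof -
        have "(\<Sum>i<n. p i * cnj (p i)) = of_real ((cl2 n p)\<^sup>2)"
          by (rule sum_mult_cnj)
        then show ?thesis using p by (simp add: mult.assoc flip: sum_distrib_left)
      qed
      finally have cdet_A': "cdet n (\<lambda>i j. A' (i, j)) = of_real (sqrt (1 - e)) ^ n * (1 + of_real t) * cdet n (\<lambda>i j. A (i, j))" .
      have norm_t: "cmod (1 + complex_of_real t) = 1 + t"
        using norm_of_real[of "1 + t", where 'a = complex] t(2) by simp
      have norm_e: "cmod (complex_of_real (sqrt (1 - e))) = sqrt (1 - e)" using e(2) by simp
      have "f A' = cmod (cdet n (\<lambda>i j. A' (i, j)))" by (simp only: f_def)
      also have "\<dots> = sqrt (1 - e) ^ n * (1 + t) * cmod (cdet n (\<lambda>i j. A (i, j)))"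
        by (subst cdet_A') (simp only: norm_mult norm_power norm_t norm_e)
      finally have "f A' = (sqrt (1 - e) ^ n * (1 + t)) * f A" by (simp only: f_def)
      moreover have "sqrt (1 - e) ^ n * (1 + t) > 1"
      proof (rule power2_less_imp_less)
        have "(sqrt (1 - e) ^ n * (1 + t))\<^sup>2 = ((sqrt (1 - e))\<^sup>2) ^ n * (1 + t)\<^sup>2"
          by (simp add: power_mult_distrib flip: power_mult add: mult.commute)
        also have "\<dots> > 1" using e by (simp add: t(1))
        finally show "1\<^sup>2 < (sqrt (1 - e) ^ n * (1 + t))\<^sup>2" by simp
      qed (use t e in simp)
      ultimately have "f A' > f A" using fA by simp
      with max[OF \<open>A' \<in> C\<close>] show False by simp
    qed
    then show "cl2 n (\<lambda>k. cblinfun_apply \<phi> (x k)) \<le> sqrt n"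
      unfolding c_def by (rule real_le_rsqrt)
  qed
qed

lemma sqrt_dim_le_cb_norm:
  assumes dim: "has_cdim (UNIV :: 'g::complex_normed_vector set) n"
  shows "ennreal (sqrt n) \<le> ennreal ((50 / 7)\<^sup>2) * cb_norm min_mnorms max_mnorms (id :: 'g::complex_normed_vector \<Rightarrow> 'g)"
proof (cases "n = 0")
  case False
  obtain x :: "nat \<Rightarrow> 'g" and \<psi> :: "nat \<Rightarrow> 'g dual" where john:
    "\<And>k. k < n \<Longrightarrow> \<psi> k (x k) = 1"
    "\<And>z. cl2 n (\<lambda>k. cblinfun_apply (\<psi> k) z) \<le> norm z"
    "\<And>\<phi> :: 'g dual. norm \<phi> \<le> 1 \<Longrightarrow> cl2 n (\<lambda>k. cblinfun_apply \<phi> (x k)) \<le> sqrt n"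
    by (rule john_biorthogonal_system[OF dim]) (rule that, assumption+)
  obtain J :: "'g \<Rightarrow>\<^sub>C\<^sub>L 'g" where J: "\<And>z. J z = id z"
    by (rule exists_cblinfun[of id 1]) auto
  have id: "cblinfun_apply J = id" using J by (rule ext)
  have "cl2 n (\<lambda>k. cblinfun_apply \<Phi> (\<psi> k)) \<le> 1" if "norm \<Phi> \<le> 1" for \<Phi> :: "'g dual dual"
    by (rule cl2_bidual_le[OF _ _ that]) (use john(2) in simp_all)
  then have "ennreal (cmod (\<Sum>k<n. \<psi> k (J (x k)))) \<le> ennreal ((50 / 7)\<^sup>2 * (sqrt n * 1)) * amp_norm n min_mnorms max_mnorms J"
    using False by (intro pairing_le_amp_norm john(3)) auto
  also have "cmod (\<Sum>k<n. \<psi> k (J (x k))) = n"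
  proof -
    have "(\<Sum>k<n. \<psi> k (J (x k))) = (\<Sum>k<n. 1)" by (intro sum.cong) (simp_all add: id john(1))
    then show ?thesis by simp
  qed
  finally have "ennreal n \<le> ennreal (sqrt n) * (ennreal ((50 / 7)\<^sup>2) * amp_norm n min_mnorms max_mnorms J)"
    by (simp add: ennreal_mult mult_ac)
  then have "ennreal (1 / sqrt n) * ennreal n \<le> ennreal (1 / sqrt n) * (ennreal (sqrt n) * (ennreal ((50 / 7)\<^sup>2) * amp_norm n min_mnorms max_mnorms J))"
    by (rule mult_left_mono) simp
  also have "\<dots> = ennreal ((50 / 7)\<^sup>2) * amp_norm n min_mnorms max_mnorms J"
    using False by (simp add: mult.assoc[symmetric] flip: ennreal_mult')
  also have "\<dots> \<le> ennreal ((50 / 7)\<^sup>2) * cb_norm min_mnorms max_mnorms (id :: 'g \<Rightarrow> 'g)"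
    unfolding cb_norm_def id by (intro mult_left_mono SUP_upper) auto
  also have "ennreal (1 / sqrt n) * ennreal n = ennreal (sqrt n)"
    by (simp add: real_div_sqrt flip: ennreal_mult)
  finally show ?thesis .
qed simp

theorem proposition2p4:
  shows "(\<forall>(n::nat) (T :: 'e::cbanach \<Rightarrow>\<^sub>C\<^sub>L 'f::cbanach). rank_at_most T n \<longrightarrow>
            gamma2_star T \<le> 170 * amp_norm n min_mnorms max_mnorms (cblinfun_apply T))
       \<and> (\<forall>n::nat. has_cdim (UNIV :: 'g::cbanach set) n \<longrightarrow>
            ennreal (sqrt (real n)) \<le> ennreal ((pi * (1 + sqrt 2))\<^sup>2)
              * cb_norm min_mnorms max_mnorms (id :: 'g \<Rightarrow> 'g))"
proof (intro conjI allI impI)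
  fix n :: nat and T :: "'e \<Rightarrow>\<^sub>C\<^sub>L 'f"
  assume "rank_at_most T n"
  then show "gamma2_star T \<le> 170 * amp_norm n min_mnorms max_mnorms T" by (rule gamma2_star_le_amp_norm)
next
  fix n :: nat
  assume "has_cdim (UNIV :: 'g set) n"
  then have "ennreal (sqrt n) \<le> ennreal ((50 / 7)\<^sup>2) * cb_norm min_mnorms max_mnorms (id :: 'g \<Rightarrow> 'g)"
    by (rule sqrt_dim_le_cb_norm)
  also have "\<dots> \<le> ennreal ((pi * (1 + sqrt 2))\<^sup>2) * cb_norm min_mnorms max_mnorms (id :: 'g \<Rightarrow> 'g)"
  proof -
    have "7 / 5 \<le> sqrt 2" by (rule real_le_rsqrt) (simp add: power2_eq_square)
    then have "3 * (1 + 7 / 5) \<le> pi * (1 + sqrt 2)" using pi_gt3 by (intro mult_mono) auto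
    then have "(50 / 7)\<^sup>2 \<le> (pi * (1 + sqrt 2))\<^sup>2" by (intro power_mono) auto
    then show ?thesis by (intro mult_right_mono ennreal_leI) auto
  qed
  finally show "ennreal (sqrt n) \<le> ennreal ((pi * (1 + sqrt 2))\<^sup>2) * cb_norm min_mnorms max_mnorms (id :: 'g \<Rightarrow> 'g)" .
qed

end
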